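(* Let $\mathfrak a$ be a Euclidean vector space and $V\subset\mathfrak{so}(\mathfrak a)$ a linear subspace which is a GO subspace. Then $V$ is of centralizer type if and only if $V$ is contained in a nice subalgebra of $\mathfrak{so}(\mathfrak a)$.
   Context: $\mathfrak{so}(\mathfrak a)$ is the Lie algebra of skew-symmetric endomorphisms of the finite-dimensional real Euclidean space $\mathfrak a$. For a linear subspace $V\subset\mathfrak{so}(\mathfrak a)$ put $\mathcal C(V)=\{A\in\mathfrak{so}(\mathfrak a)\mid[A,V]=0\}$ and $\mathcal N(V)=\{A\in\mathfrak{so}(\mathfrak a)\mid[A,V]\subset V\}$. $V$ is a GO subspace if for every $J\in V$ and $X\in\mathfrak a$ there exists $N\in\mathcal N(V)$ with $[N,J]=0$ and $NX=JX$. $V$ is of centralizer type if for every $J\in V$ and $X\in\mathfrak a$ there exists $N\in\mathcal C(V)$ with $NX=JX$. Nice subalgebras: choose an orthogonal decomposition $\mathfrak a=\bigoplus_{i=1}^pU_i\oplus\bigoplus_{j=1}^qW_j\oplus Z$ with $p,q\ge 0$, $\dim U_i=4$ and $\dim W_j=2$. Then $\mathfrak{so}(U_i)\simeq\mathfrak{so}(4)=\mathfrak s_i\oplus\mathfrak s_i'$, where $\mathfrak s_i,\mathfrak s_i'$ are the two ideals isomorphic to $\mathfrak{so}(3)$ (in either order). Any subalgebra of $\mathfrak{so}(\mathfrak a)$ of the form $\mathfrak f=\bigoplus_{i=1}^p\mathfrak s_i\oplus\bigoplus_{j=1}^q\mathfrak{so}(W_j)$ is called nice (for a subspace $L\subset\mathfrak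 a$, $\mathfrak{so}(L)$ is regarded as the subalgebra of elements of $\mathfrak{so}(\mathfrak a)$ that vanish on $L^\perp$). *)

theory Defs
  imports "HOL-Analysis.Analysis"
begin

text \<open>The finite-dimensional real Euclidean space is the type \<open>'a\<close> of class \<open>euclidean_space\<close>,
  and its endomorphisms are the bounded linear maps \<open>'a \<Rightarrow>\<^sub>L 'a\<close>: every linear map between
  finite-dimensional spaces is bounded.\<close>

definition so :: "('a::euclidean_space \<Rightarrow>\<^sub>L 'a) set" where
  "so = {A. \<forall>x y. blinfun_apply A x \<bullet> y = - (x \<bullet> blinfun_apply A y)}"

definition bracket ::
    "('a::euclidean_space \<Rightarrow>\<^sub>L 'a) \<Rightarrow> ('a \<Rightarrow>\<^sub>L 'a) \<Rightarrow> ('a \<Rightarrow>\<^sub>L 'a)" where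
  "bracket A B = (A o\<^sub>L B) - (B o\<^sub>L A)"

definition centralizer_so ::
    "('a::euclidean_space \<Rightarrow>\<^sub>L 'a) set \<Rightarrow> ('a \<Rightarrow>\<^sub>L 'a) set" where
  "centralizer_so V = {A \<in> so. \<forall>B\<in>V. bracket A B = 0}"

definition normalizer_so ::
    "('a::euclidean_space \<Rightarrow>\<^sub>L 'a) set \<Rightarrow> ('a \<Rightarrow>\<^sub>L 'a) set" where
  "normalizer_so V = {A \<in> so. \<forall>B\<in>V. bracket A B \<in> V}"

definition GO_subspace :: "('a::euclidean_space \<Rightarrow>\<^sub>L 'a) set \<Rightarrow> bool" where
  "GO_subspace V \<longleftrightarrow>
     (\<forall>J\<in>V. \<forall>X. \<exists>N\<in>normalizer_so V.
        bracket N J = 0 \<and> blinfun_apply N X = blinfun_apply J X)"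

definition centralizer_type :: "('a::euclidean_space \<Rightarrow>\<^sub>L 'a) set \<Rightarrow> bool" where
  "centralizer_type V \<longleftrightarrow>
     (\<forall>J\<in>V. \<forall>X. \<exists>N\<in>centralizer_so V. blinfun_apply N X = blinfun_apply J X)"

definition so_on :: "'a::euclidean_space set \<Rightarrow> ('a \<Rightarrow>\<^sub>L 'a) set" where
  "so_on L = {A \<in> so. \<forall>x \<in> L\<^sup>\<bottom>. blinfun_apply A x = 0}"

definition lie_subalgebra :: "('a::euclidean_space \<Rightarrow>\<^sub>L 'a) set \<Rightarrow> bool" where
  "lie_subalgebra g \<longleftrightarrow> subspace g \<and> (\<forall>A\<in>g. \<forall>B\<in>g. bracket A B \<in> g)"

definition lie_ideal ::
    "('a::euclidean_space \<Rightarrow>\<^sub>L 'a) set \<Rightarrow> ('a \<Rightarrow>\<^sub>L 'a) set \<Rightarrow> bool" where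
  "lie_ideal h g \<longleftrightarrow>
     subspace h \<and> h \<subseteq> g \<and> (\<forall>A\<in>g. \<forall>B\<in>h. bracket A B \<in> h)"

definition lie_isomorphic ::
    "('a::euclidean_space \<Rightarrow>\<^sub>L 'a) set \<Rightarrow> ('b::euclidean_space \<Rightarrow>\<^sub>L 'b) set \<Rightarrow> bool" where
  "lie_isomorphic g h \<longleftrightarrow>
     (\<exists>\<phi>. bij_betw \<phi> g h \<and>
          (\<forall>A\<in>g. \<forall>B\<in>g. \<phi> (A + B) = \<phi> A + \<phi> B) \<and>
          (\<forall>c. \<forall>A\<in>g. \<phi> (c *\<^sub>R A) = c *\<^sub>R \<phi> A) \<and>
          (\<forall>A\<in>g. \<forall>B\<in>g. \<phi> (bracket A B) = bracket (\<phi> A) (\<phi> B)))"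

text \<open>The two summands of \<open>so(4)\<close> play symmetric roles, so \<open>s\<close> below is either of them.\<close>

definition so4_summand ::
    "('a::euclidean_space \<Rightarrow>\<^sub>L 'a) set \<Rightarrow> 'a set \<Rightarrow> bool" where
  "so4_summand s U \<longleftrightarrow>
     (\<exists>s'. lie_ideal s (so_on U) \<and> lie_ideal s' (so_on U) \<and>
           lie_isomorphic s (so :: ((real^3) \<Rightarrow>\<^sub>L (real^3)) set) \<and>
           lie_isomorphic s' (so :: ((real^3) \<Rightarrow>\<^sub>L (real^3)) set) \<and>
           s \<inter> s' = {0} \<and> so_on U = {A + B | A B. A \<in> s \<and> B \<in> s'})"

definition orthogonal_sets :: "'a::euclidean_space set \<Rightarrow> 'a set \<Rightarrow> bool" where
  "orthogonal_sets S T \<longleftrightarrow> (\<forall>x\<in>S. \<forall>y\<in>T. orthogonal x y)"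

text \<open>The sum of a family of subspaces is the span of its union; it is direct as soon as the
  members are pairwise orthogonal.\<close>

definition nice_decomposition ::
    "nat \<Rightarrow> nat \<Rightarrow> (nat \<Rightarrow> 'a::euclidean_space set) \<Rightarrow> (nat \<Rightarrow> 'a set) \<Rightarrow> 'a set \<Rightarrow> bool" where
  "nice_decomposition p q U W Z \<longleftrightarrow>
     (\<forall>i<p. subspace (U i) \<and> dim (U i) = 4) \<and>
     (\<forall>j<q. subspace (W j) \<and> dim (W j) = 2) \<and>
     subspace Z \<and>
     (\<forall>i<p. \<forall>i'<p. i \<noteq> i' \<longrightarrow> orthogonal_sets (U i) (U i')) \<and>
     (\<forall>j<q. \<forall>j'<q. j \<noteq> j' \<longrightarrow> orthogonal_sets (W j) (W j')) \<and>
     (\<forall>i<p. \<forall>j<q. orthogonal_sets (U i) (W j)) \<and>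
     (\<forall>i<p. orthogonal_sets (U i) Z) \<and>
     (\<forall>j<q. orthogonal_sets (W j) Z) \<and>
     span ((\<Union>i<p. U i) \<union> (\<Union>j<q. W j) \<union> Z) = UNIV"

text \<open>In \<open>nice_subalgebra\<close> the sum is direct because the summands act on pairwise orthogonal
  subspaces.\<close>

definition nice_subalgebra :: "('a::euclidean_space \<Rightarrow>\<^sub>L 'a) set \<Rightarrow> bool" where
  "nice_subalgebra f \<longleftrightarrow> lie_subalgebra f \<and> f \<subseteq> so \<and>
     (\<exists>p q U W Z s. nice_decomposition p q U W Z \<and>
        (\<forall>i<p. so4_summand (s i) (U i)) \<and>
        f = span ((\<Union>i<p. s i) \<union> (\<Union>j<q. so_on (W j))))"

end

theory Submission
  imports Defs
begin

text \<open>Suppose \<open>V\<close> is of centralizer type, and split \<open>a\<close> orthogonally into irreducible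
  \<open>V\<close>-invariant subspaces \<open>E\<close>. Let \<open>C\<close> be the skew endomorphisms of \<open>E\<close> commuting with \<open>V\<close>.
  By Schur's lemma \<open>N\<^sup>2\<close> is a nonpositive scalar on \<open>E\<close> for \<open>N \<in> C\<close>, and since \<open>J x \<in> C x\<close> for
  \<open>J \<in> V\<close>, the space \<open>\<real> x + C x\<close> is invariant, hence all of \<open>E\<close>. So \<open>\<real> + C\<close> is
  \<open>\<real>\<close>, the complex numbers or the quaternions, \<open>dim E\<close> is 1, 2 or 4, and in the last case \<open>V\<close> acts
  on \<open>E\<close> by the imaginary quaternions multiplying from the other side.

  Conversely, both ideals of \<open>so(4)\<close> act transitively on spheres and commute with each other, so the
  action on \<open>x\<close> of an element of one ideal is matched by an element of the other.\<close>

section \<open>Skew endomorphisms\<close>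

text \<open>\<open>so4_summand\<close> knows its two ideals only abstractly, whereas the converse
  needs transitivity on spheres, a property of concrete operators. The bridge is
  \<open>ideal_contains_qmult\<close>: in quaternion coordinates every nonzero ideal contains all
  left or all right multiplications by imaginary quaternions. A sign \<open>\<sigma>\<close> with
  \<open>\<sigma> * \<sigma> = 1\<close> treats both sides at once. In the forward direction an
  element of the centralizer need not preserve \<open>E\<close>, so it is compressed by the
  orthogonal projection; this keeps it in the centralizer because skewness makes the complement of
  an invariant subspace invariant too. \<open>C\<close> is closed under commutators but generally
  not under products, while anticommutators are scalars on \<open>E\<close> by polarizing Schur's
  lemma; these two facts stand in for the multiplication of the division algebra. The action of
  \<open>V\<close> from the other side is then forced: \<open>J\<close> commutes with
  \<open>C\<close> and \<open>x\<close> generates \<open>E\<close>, so \<open>J\<close> is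
  determined by \<open>J x\<close>.\<close>

lemma bracket_apply: "blinfun_apply (bracket A B) x = A (B x) - B (A x)"
  by (simp add: bracket_def blinfun.bilinear_simps)

lemma bracket_eq_0_iff: "bracket A B = 0 \<longleftrightarrow> (\<forall>x. A (B x) = B (A x))"
proof -
  have "bracket A B = 0 \<longleftrightarrow> (\<forall>x. blinfun_apply (bracket A B) x = 0)"
    by (metis blinfun_eqI zero_blinfun.rep_eq)
  then show ?thesis by (simp add: bracket_apply)
qed

lemma bracket_anticomm: "bracket A B = - bracket B A"
  by (simp add: bracket_def)

lemma bracket_add_left: "bracket (A + B) C = bracket A C + bracket B C"
  and bracket_add_right: "bracket C (A + B) = bracket C A + bracket C B"
  and bracket_scaleR_left: "bracket (r *\<^sub>R A) C = r *\<^sub>R bracket A C"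
  and bracket_scaleR_right: "bracket C (r *\<^sub>R A) = r *\<^sub>R bracket C A"
  by (auto intro!: blinfun_eqI simp: bracket_apply blinfun.bilinear_simps algebra_simps)

lemma bracket_0 [simp]: "bracket 0 A = 0" "bracket A 0 = 0"
  by (auto intro!: blinfun_eqI simp: bracket_apply blinfun.bilinear_simps)

lemma so_inner: "A \<in> so \<Longrightarrow> A x \<bullet> y = - (x \<bullet> A y)"
  by (simp add: so_def)

lemma so_inner_self: "A \<in> so \<Longrightarrow> A x \<bullet> x = 0"
  using so_inner[of A x x] by (simp add: inner_commute)

lemma subspace_so: "subspace so"
  by (auto simp: subspace_def so_def blinfun.bilinear_simps inner_simps)

lemma bracket_in_so: "A \<in> so \<Longrightarrow> B \<in> so \<Longrightarrow> bracket A B \<in> so"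
  by (simp add: so_def bracket_apply inner_simps)

lemma subspace_so_on: "subspace (so_on L)"
  by (auto simp: subspace_def so_on_def so_def blinfun.bilinear_simps inner_simps)

lemma so_on_subset: "so_on L \<subseteq> so"
  by (auto simp: so_on_def)

lemma bracket_in_so_on: "A \<in> so_on L \<Longrightarrow> B \<in> so_on L \<Longrightarrow> bracket A B \<in> so_on L"
  by (auto simp: so_on_def bracket_in_so bracket_apply blinfun.bilinear_simps)

lemma so_on_range:
  assumes "subspace L" "A \<in> so_on L"
  shows "A x \<in> L"
proof -
  have "A x \<in> L\<^sup>\<bottom>\<^sup>\<bottom>"
    using assms(2) unfolding orthogonal_comp_def so_on_def
    by (auto simp: orthogonal_def inner_commute[of _ "A x"] so_inner)
  then show ?thesis
    using assms(1) orthogonal_comp_self by blast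
qed

lemma so_on_orthogonal_zero:
  assumes "A \<in> so_on S" "\<And>y. y \<in> S \<Longrightarrow> orthogonal y x"
  shows "A x = 0"
  using assms by (auto simp: so_on_def orthogonal_comp_def)

lemma so_on_orthogonal_commute:
  assumes "A \<in> so_on S" "B \<in> so_on T" "subspace S" "subspace T" "orthogonal_sets S T"
  shows "bracket A B = 0"
proof -
  have "A (B x) = 0" for x
    using so_on_range[OF assms(4,2)] assms(5)
    by (intro so_on_orthogonal_zero[OF assms(1)]) (simp add: orthogonal_sets_def)
  moreover have "B (A x) = 0" for x
    using so_on_range[OF assms(3,1)] assms(5)
    by (intro so_on_orthogonal_zero[OF assms(2)]) (metis orthogonal_sets_def orthogonal_commute)
  ultimately show ?thesis by (simp add: bracket_eq_0_iff)
qed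

section \<open>Orthogonal projections\<close>

lemma orthogonal_projection_exists:
  fixes E :: "'a::euclidean_space set"
  assumes "subspace E"
  shows "\<exists>P :: 'a \<Rightarrow>\<^sub>L 'a. (\<forall>x. P x \<in> E) \<and> (\<forall>x\<in>E. P x = x) \<and> (\<forall>x y. P x \<bullet> y = x \<bullet> P y)"
proof -
  obtain B where B: "B \<subseteq> E" "pairwise orthogonal B" "\<And>x. x \<in> B \<Longrightarrow> norm x = 1"
    "independent B" "card B = dim E" "span B = E"
    using orthonormal_basis_subspace[OF assms] by metis
  have fin: "finite B" using B(4) by (simp add: independent_imp_finite)
  define p where "p = (\<lambda>x. \<Sum>b\<in>B. (x \<bullet> b) *\<^sub>R b)"
  have lin: "linear p"
    unfolding p_def by (auto intro!: linearI simp: inner_simps scaleR_left_distrib sum.distrib scaleR_sum_right)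
  have id: "p x = x" if "x \<in> E" for x
    unfolding p_def using that B fin by (intro orthonormal_basis_expand) auto
  have sym: "p x \<bullet> y = x \<bullet> p y" for x y
    unfolding p_def by (simp add: inner_sum_left inner_sum_right inner_commute mult.commute)
  have rng: "p x \<in> E" for x
    unfolding p_def using B(1) assms by (auto intro!: subspace_sum subspace_scale)
  have bl: "blinfun_apply (Blinfun p) = p"
    using lin by (simp add: bounded_linear_Blinfun_apply linear_conv_bounded_linear)
  show ?thesis
    by (rule exI[of _ "Blinfun p"]) (auto simp: bl id sym rng)
qed

text \<open>The three properties determine the map, so the choice is harmless. A bounded linear map,
  rather than a function, can be composed with elements of \<open>so\<close>.\<close>

definition proj :: "'a::euclidean_space set \<Rightarrow> 'a \<Rightarrow>\<^sub>L 'a" where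
  "proj E = (SOME P :: 'a \<Rightarrow>\<^sub>L 'a. (\<forall>x. P x \<in> E) \<and> (\<forall>x\<in>E. P x = x) \<and> (\<forall>x y. P x \<bullet> y = x \<bullet> P y))"

lemma
  assumes "subspace E"
  shows proj_in: "proj E x \<in> E"
    and proj_id: "x \<in> E \<Longrightarrow> proj E x = x"
    and proj_sym: "proj E x \<bullet> y = x \<bullet> proj E y"
  using someI_ex[OF orthogonal_projection_exists[OF assms]] unfolding proj_def by blast+

lemma proj_orthogonal:
  assumes "subspace E" "\<And>y. y \<in> E \<Longrightarrow> orthogonal y x"
  shows "proj E x = 0"
proof -
  have "proj E x \<bullet> proj E x = proj E (proj E x) \<bullet> x"
    using assms(1) by (simp add: proj_sym)
  also have "\<dots> = 0"
    using assms proj_in[OF assms(1)] by (simp add: orthogonal_def)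
  finally show ?thesis by simp
qed

lemma proj_diff_orthogonal:
  assumes "subspace E" "y \<in> E"
  shows "orthogonal y (x - proj E x)"
  using assms by (simp add: orthogonal_def inner_diff_right proj_sym[symmetric] proj_id)

lemma so_on_proj:
  assumes "subspace E" "A \<in> so_on E"
  shows "A (proj E x) = A x"
proof -
  have "A (x - proj E x) = 0"
    using proj_diff_orthogonal[OF assms(1)] by (intro so_on_orthogonal_zero[OF assms(2)])
  then show ?thesis by (simp add: blinfun.bilinear_simps)
qed

lemma so_on_eqI:
  assumes "subspace E" "A \<in> so_on E" "B \<in> so_on E" "\<And>x. x \<in> E \<Longrightarrow> A x = B x"
  shows "A = B"
  using assms proj_in so_on_proj by (metis blinfun_eqI)

text \<open>Compression by a symmetric operator preserves skewness. This cuts an endomorphism of the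
  whole space down to \<open>E\<close> even when it does not leave \<open>E\<close>
  invariant.\<close>

lemma proj_compress_so_on:
  assumes "subspace E" "A \<in> so"
  shows "proj E o\<^sub>L A o\<^sub>L proj E \<in> so_on E"
  using assms by (auto simp: so_on_def so_def proj_sym blinfun.bilinear_simps orthogonal_comp_def proj_orthogonal)

text \<open>By skewness the orthogonal complement of \<open>E\<close> is invariant as well, so
  \<open>A\<close> respects both components of \<open>x\<close>.\<close>

lemma so_invariant_proj_commute:
  assumes "subspace E" "A \<in> so" "\<And>x. x \<in> E \<Longrightarrow> A x \<in> E"
  shows "proj E (A x) = A (proj E x)"
proof -
  let ?z = "x - proj E x"
  have "proj E (A ?z) = 0"
  proof (rule proj_orthogonal[OF assms(1)])
    fix y assume "y \<in> E"
    then show "orthogonal y (A ?z)"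
      using proj_diff_orthogonal[OF assms(1) assms(3)[OF \<open>y \<in> E\<close>], of x] so_inner[OF assms(2), of y ?z]
      by (simp add: orthogonal_def)
  qed
  then show ?thesis
    using assms by (simp add: blinfun.bilinear_simps proj_in proj_id)
qed

section \<open>Quaternionic frames of a four-dimensional subspace\<close>

lemma skew_real3_eq_cross3:
  fixes f :: "real^3 \<Rightarrow> real^3"
  assumes "\<And>x y. f x \<bullet> y = - (x \<bullet> f y)"
  shows "\<exists>b. \<forall>y. f y = cross3 b y"
proof -
  define m where "m i j = f (axis i 1) $ j" for i j
  have comp: "f y $ i = - (\<Sum>j\<in>UNIV. y $ j * m i j)" for y i
    using assms[of y "axis i 1"] by (simp add: inner_axis) (simp add: inner_vec_def m_def)
  have anti: "m i j = - m j i" for i j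
    using assms[of "axis i 1" "axis j 1"] by (simp add: inner_axis inner_axis' m_def)
  have diag: "m i i = 0" for i using anti[of i i] by simp
  \<comment> \<open>The vector collects the three independent off-diagonal entries;
    \<open>comp\<close> has already extracted linearity from skewness.\<close>
  have "f y = cross3 (vector [m 2 3, m 3 1, m 1 2]) y" for y
    using anti[of 2 1] anti[of 3 2] anti[of 1 3]
    by (simp add: vec_eq_iff forall_3 comp sum_3 diag cross_components algebra_simps)
  then show ?thesis by blast
qed

text \<open>The structure constant \<open>c\<close> is absorbed by letting \<open>hat v\<close> be
  the cross product with \<open>c v\<close>: both \<open>hat (c *\<^sub>R cross3 v w)\<close> and
  the bracket of \<open>hat v\<close> and \<open>hat w\<close> then carry the factor
  \<open>c * c\<close>.\<close>

lemma so_isomorphic_cross3: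
  fixes F :: "real^3 \<Rightarrow> ('a::euclidean_space \<Rightarrow>\<^sub>L 'a)"
  assumes lin: "linear F" and inj: "inj F" and c: "c \<noteq> 0"
    and br: "\<And>v w. bracket (F v) (F w) = F (c *\<^sub>R cross3 v w)"
  shows "lie_isomorphic (range F) (so :: ((real^3) \<Rightarrow>\<^sub>L (real^3)) set)"
proof -
  define hat :: "real^3 \<Rightarrow> ((real^3) \<Rightarrow>\<^sub>L (real^3))" where "hat v = Blinfun (cross3 (c *\<^sub>R v))" for v
  have hat [simp]: "blinfun_apply (hat v) = cross3 (c *\<^sub>R v)" for v
    unfolding hat_def
    by (intro bounded_linear_Blinfun_apply)
      (simp add: linear_conv_bounded_linear[symmetric] linear_iff cross_add_right cross_mult_right)
  have hat_so: "hat v \<in> so" for v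
    by (simp add: so_def cross3_simps)
  have surj: "A \<in> range hat" if A: "A \<in> so" for A
  proof -
    obtain b where b: "\<And>y. A y = cross3 b y"
      using skew_real3_eq_cross3[of A] A by (auto simp: so_def)
    have "A = hat ((1/c) *\<^sub>R b)"
      using c b by (auto intro!: blinfun_eqI)
    then show ?thesis by blast
  qed
  have inj_hat: "inj hat"
  proof (rule injI)
    fix v w assume "hat v = hat w"
    then have "\<And>y. cross3 (c *\<^sub>R v) y = cross3 (c *\<^sub>R w) y" by (metis hat)
    then have "cross3 (v - w) y = 0" for y
      using c by (simp add: cross_mult_left Cross3.left_diff_distrib)
    then show "v = w" using cross_basis_nonzero[of "v - w"] by auto
  qed
  have hat_br: "hat (c *\<^sub>R cross3 v w) = bracket (hat v) (hat w)" for v w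
    by (rule blinfun_eqI) (simp add: bracket_apply cross3_simps forall_3)
  define G where "G = inv F"
  have G [simp]: "G (F v) = v" for v using inj by (simp add: G_def)
  have "bij_betw (hat \<circ> G) (range F) so"
    unfolding bij_betw_def
    using inj_hat surj hat_so by (fastforce simp: inj_on_def image_iff)
  moreover have "hat (v + w) = hat v + hat w" "hat (r *\<^sub>R v) = r *\<^sub>R hat v" for v w r
    by (auto intro!: blinfun_eqI simp: blinfun.bilinear_simps cross_add_left cross_mult_left scaleR_add_right)
  ultimately show ?thesis
    unfolding lie_isomorphic_def
    by (intro exI[of _ "hat \<circ> G"])
      (auto simp: br hat_br[symmetric] linear_add[OF lin, symmetric] linear_scale[OF lin, symmetric])
qed

text \<open>Supplies the nonzero ideal that \<open>ideal_contains_qmult\<close> asks for. Counting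
  points suffices: a bijection from \<open>{0}\<close> would leave so(3) a single point.\<close>

lemma nonzero_if_isomorphic_so3:
  assumes "lie_isomorphic s (so :: ((real^3) \<Rightarrow>\<^sub>L (real^3)) set)"
  shows "s \<noteq> {0}"
proof
  assume s: "s = {0}"
  obtain \<phi> where \<phi>: "bij_betw \<phi> s (so :: ((real^3) \<Rightarrow>\<^sub>L (real^3)) set)"
    using assms by (auto simp: lie_isomorphic_def)
  then have eq: "(so :: ((real^3) \<Rightarrow>\<^sub>L (real^3)) set) = {\<phi> 0}"
    by (simp add: s bij_betw_def)
  define A :: "(real^3) \<Rightarrow>\<^sub>L (real^3)" where "A = Blinfun (cross3 (axis 1 1))"
  have A: "blinfun_apply A = cross3 (axis 1 1)"
    unfolding A_def
    by (intro bounded_linear_Blinfun_apply)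
      (simp add: linear_conv_bounded_linear[symmetric] linear_iff cross_add_right cross_mult_right)
  have "A \<in> so" by (simp add: so_def A cross3_simps)
  moreover have "0 \<in> (so :: ((real^3) \<Rightarrow>\<^sub>L (real^3)) set)"
    using subspace_so subspace_0 by blast
  ultimately have "A = 0" by (metis eq singletonD)
  then have "cross3 (axis 1 1) (axis 2 1 :: real^3) = 0" using A by (metis zero_blinfun.rep_eq)
  then show False by (simp add: cross_basis axis_eq_0_iff)
qed

text \<open>A frame identifies a four-dimensional subspace with the quaternions: \<open>e\<close> is the unit and
  \<open>\<iota>\<close> the inclusion of the imaginary part.\<close>

locale quaternion_frame =
  fixes e :: "'a::euclidean_space" and \<iota> :: "real^3 \<Rightarrow> 'a"
  assumes linear_\<iota>: "linear \<iota>"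
    and e_unit: "e \<bullet> e = 1"
    and \<iota>_isometry: "\<iota> v \<bullet> \<iota> w = v \<bullet> w"
    and e_\<iota>: "e \<bullet> \<iota> v = 0"
begin

definition emb :: "real \<Rightarrow> real^3 \<Rightarrow> 'a" where "emb r v = r *\<^sub>R e + \<iota> v"
definition re :: "'a \<Rightarrow> real" where "re x = x \<bullet> e"
text \<open>As an adjoint, rather than an inverse of \<open>\<iota>\<close>, this is defined on the
  whole space and vanishes on the complement of \<open>quat\<close>, so formulas in
  \<open>re\<close> and \<open>im\<close> extend by zero automatically.\<close>

definition im :: "'a \<Rightarrow> real^3" where "im = adjoint \<iota>"
definition quat :: "'a set" where "quat = {emb r v | r v. True}"

lemma inner_im: "im x \<bullet> v = x \<bullet> \<iota> v" and inner_im': "v \<bullet> im x = \<iota> v \<bullet> x"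
  by (metis im_def adjoint_clauses[OF linear_\<iota>] inner_commute)+

lemma linear_im: "linear im"
  by (simp add: im_def adjoint_linear linear_\<iota>)

lemma inner_emb: "x \<bullet> emb r v = re x * r + im x \<bullet> v" "emb r v \<bullet> x = re x * r + im x \<bullet> v"
  by (simp_all add: emb_def re_def inner_im inner_simps inner_commute[of _ x])

lemma im_\<iota> [simp]: "im (\<iota> v) = v"
  by (rule vector_eq_rdot[THEN iffD1]) (simp add: inner_im \<iota>_isometry)

lemma im_e [simp]: "im e = 0"
  by (rule vector_eq_rdot[THEN iffD1]) (simp add: inner_im e_\<iota>)

lemma re_emb [simp]: "re (emb r v) = r"
  using e_\<iota>[of v] by (simp add: re_def emb_def inner_simps e_unit inner_commute)

lemma im_emb [simp]: "im (emb r v) = v"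
  by (simp add: emb_def linear_add[OF linear_im] linear_scale[OF linear_im])

lemma emb_add: "emb r v + emb s w = emb (r + s) (v + w)"
  by (simp add: emb_def linear_add[OF linear_\<iota>] scaleR_left_distrib)

lemma emb_scale: "c *\<^sub>R emb r v = emb (c * r) (c *\<^sub>R v)"
  by (simp add: emb_def linear_scale[OF linear_\<iota>] scaleR_right_distrib)

lemma emb_diff: "emb r v - emb s w = emb (r - s) (v - w)"
  by (simp add: emb_def linear_diff[OF linear_\<iota>] scaleR_left_diff_distrib)

lemma emb_0: "emb 0 0 = 0"
  by (simp add: emb_def linear_0[OF linear_\<iota>])

lemma emb_eq_iff [simp]: "emb r v = emb s w \<longleftrightarrow> r = s \<and> v = w"
  by (metis re_emb im_emb)

lemma emb_in_quat [simp]: "emb r v \<in> quat"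
  by (auto simp: quat_def)

lemma quat_emb: "x \<in> quat \<Longrightarrow> emb (re x) (im x) = x"
  by (auto simp: quat_def)

lemma subspace_quat: "subspace quat"
  unfolding subspace_def quat_def using emb_0 by (fastforce simp: emb_add emb_scale)

text \<open>\<open>emb (re x) (im x)\<close> is the orthogonal projection of \<open>x\<close> to
  \<open>quat\<close>.\<close>

lemma so_on_quat_emb:
  assumes "A \<in> so_on quat"
  shows "A (emb (re x) (im x)) = A x"
proof -
  have "A (x - emb (re x) (im x)) = 0"
  proof (rule so_on_orthogonal_zero[OF assms])
    fix y assume "y \<in> quat"
    then obtain s w where "y = emb s w" by (auto simp: quat_def)
    then show "orthogonal y (x - emb (re x) (im x))"
      by (simp add: orthogonal_def inner_diff_right inner_emb inner_commute)
  qed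
  then show ?thesis by (simp add: blinfun.bilinear_simps)
qed

text \<open>Multiplication by the imaginary quaternion \<open>v\<close>, from the left for \<open>\<sigma> = 1\<close> and
  from the right for \<open>\<sigma> = -1\<close>.\<close>

definition qmult :: "real \<Rightarrow> real^3 \<Rightarrow> 'a \<Rightarrow>\<^sub>L 'a" where
  "qmult \<sigma> v = Blinfun (\<lambda>x. emb (- (v \<bullet> im x)) (re x *\<^sub>R v + \<sigma> *\<^sub>R cross3 v (im x)))"

lemma qmult_apply:
  "blinfun_apply (qmult \<sigma> v) x = emb (- (v \<bullet> im x)) (re x *\<^sub>R v + \<sigma> *\<^sub>R cross3 v (im x))"
proof -
  have "linear (\<lambda>x. emb (- (v \<bullet> im x)) (re x *\<^sub>R v + \<sigma> *\<^sub>R cross3 v (im x)))"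
    by (rule linearI)
      (simp_all add: emb_add emb_scale linear_add[OF linear_im] linear_scale[OF linear_im] re_def
        inner_simps cross_add_right cross_mult_right algebra_simps)
  then show ?thesis
    unfolding qmult_def by (simp add: bounded_linear_Blinfun_apply linear_conv_bounded_linear)
qed

lemma qmult_linear: "linear (qmult \<sigma>)"
  by (rule linearI)
    (auto intro!: blinfun_eqI simp: qmult_apply blinfun.bilinear_simps emb_add emb_scale
      inner_simps cross_add_left cross_mult_left algebra_simps)

lemma qmult_inj: "inj (qmult \<sigma>)"
proof (rule injI)
  fix v w assume "qmult \<sigma> v = qmult \<sigma> w"
  then have "qmult \<sigma> v e = qmult \<sigma> w e" by simp
  then show "v = w" by (simp add: qmult_apply re_def e_unit)
qed

lemma qmult_so_on: "qmult \<sigma> v \<in> so_on quat"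
proof -
  have "qmult \<sigma> v \<in> so"
    unfolding so_def by (auto simp: qmult_apply inner_emb) (simp add: cross3_simps)
  moreover have "qmult \<sigma> v x = 0" if "x \<in> quat\<^sup>\<bottom>" for x
  proof -
    have "emb r w \<bullet> x = 0" for r w
      using that by (simp add: orthogonal_comp_def orthogonal_def)
    from this[of 1 0] this[of 0 "im x"] have "re x = 0" "im x = 0"
      by (simp_all add: inner_emb)
    then show ?thesis by (simp add: qmult_apply emb_0)
  qed
  ultimately show ?thesis by (simp add: so_on_def)
qed

text \<open>Imaginary quaternions satisfy v w - w v = 2 (v \<times> w); right multiplication
  reverses products, which accounts for the sign \<open>\<sigma>\<close>. The two displayed
  identities compare real and imaginary parts.\<close>

lemma qmult_bracket:
  assumes "\<sigma> * \<sigma> = 1"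
  shows "bracket (qmult \<sigma> v) (qmult \<sigma> w) = qmult \<sigma> ((2 * \<sigma>) *\<^sub>R cross3 v w)"
proof (rule blinfun_eqI)
  fix x
  have \<sigma>: "\<sigma> * (\<sigma> * t) = t" for t using assms by (simp flip: mult.assoc)
  have "- (v \<bullet> (re x *\<^sub>R w + \<sigma> *\<^sub>R cross3 w (im x))) + (w \<bullet> (re x *\<^sub>R v + \<sigma> *\<^sub>R cross3 v (im x)))
      = - ((2 * \<sigma>) *\<^sub>R cross3 v w \<bullet> im x)"
    by (simp add: cross3_simps)
  moreover have "(- (w \<bullet> im x)) *\<^sub>R v + \<sigma> *\<^sub>R cross3 v (re x *\<^sub>R w + \<sigma> *\<^sub>R cross3 w (im x))
      - ((- (v \<bullet> im x)) *\<^sub>R w + \<sigma> *\<^sub>R cross3 w (re x *\<^sub>R v + \<sigma> *\<^sub>R cross3 v (im x)))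
      = re x *\<^sub>R (2 * \<sigma>) *\<^sub>R cross3 v w + \<sigma> *\<^sub>R cross3 ((2 * \<sigma>) *\<^sub>R cross3 v w) (im x)"
    by (simp add: cross3_simps forall_3 \<sigma>)
  ultimately show "bracket (qmult \<sigma> v) (qmult \<sigma> w) x = qmult \<sigma> ((2 * \<sigma>) *\<^sub>R cross3 v w) x"
    by (simp add: bracket_apply qmult_apply emb_diff)
qed

text \<open>This is associativity of the quaternions: (v x) w = v (x w).\<close>

lemma qmult_commute:
  assumes "\<sigma> * \<sigma> = 1"
  shows "bracket (qmult \<sigma> v) (qmult (- \<sigma>) w) = 0"
proof (rule blinfun_eqI)
  fix x
  have \<sigma>: "\<sigma> * (\<sigma> * t) = t" for t using assms by (simp flip: mult.assoc)
  have "- (v \<bullet> (re x *\<^sub>R w + (- \<sigma>) *\<^sub>R cross3 w (im x))) + (w \<bullet> (re x *\<^sub>R v + \<sigma> *\<^sub>R cross3 v (im x))) = 0"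
    by (simp add: cross3_simps)
  moreover have "(- (w \<bullet> im x)) *\<^sub>R v + \<sigma> *\<^sub>R cross3 v (re x *\<^sub>R w + (- \<sigma>) *\<^sub>R cross3 w (im x))
      - ((- (v \<bullet> im x)) *\<^sub>R w + (- \<sigma>) *\<^sub>R cross3 w (re x *\<^sub>R v + \<sigma> *\<^sub>R cross3 v (im x))) = 0"
    by (simp add: cross3_simps forall_3 \<sigma>)
  ultimately show "bracket (qmult \<sigma> v) (qmult (- \<sigma>) w) x = blinfun_apply 0 x"
    by (simp add: bracket_apply qmult_apply emb_diff emb_0)
qed

text \<open>A skew \<open>A\<close> is given by the vector \<open>a0\<close> (image of the unit) and
  the vector \<open>b0\<close> (rotation of the imaginary part). \<open>qmult \<sigma> a\<close> has
  the pair a, \<sigma> a and \<open>qmult (- \<sigma>) b\<close> the pair b, -\<sigma> b; solving a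
  + b = \<open>a0\<close> and \<sigma> (a - b) = \<open>b0\<close> gives the two halves
  below.\<close>

lemma so_on_quat_decompose:
  assumes A: "A \<in> so_on quat" and \<sigma>: "\<sigma> * \<sigma> = 1"
  shows "\<exists>a b. A = qmult \<sigma> a + qmult (- \<sigma>) b"
proof -
  have Aso: "A \<in> so" using A so_on_subset by blast
  define a0 where "a0 = im (A e)"
  obtain b0 where b0: "\<And>y. im (A (\<iota> y)) = cross3 b0 y"
    using skew_real3_eq_cross3[of "\<lambda>y. im (A (\<iota> y))"] so_inner[OF Aso]
    by (auto simp: inner_im inner_im')
  have re: "re (A e) = 0" "re (A (\<iota> y)) = - (a0 \<bullet> y)" for y
    using so_inner[OF Aso, of "\<iota> y" e] so_inner_self[OF Aso]
    by (simp_all add: re_def a0_def inner_im inner_im' inner_commute)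
  have "A x = (qmult \<sigma> ((1/2) *\<^sub>R (a0 + \<sigma> *\<^sub>R b0)) + qmult (- \<sigma>) ((1/2) *\<^sub>R (a0 - \<sigma> *\<^sub>R b0))) x" for x
  proof -
    have s: "\<sigma> * (\<sigma> * t) = t" for t using \<sigma> by (simp flip: mult.assoc)
    have "A x = A (emb (re x) (im x))" by (simp add: so_on_quat_emb[OF A])
    also have "\<dots> = re x *\<^sub>R A e + A (\<iota> (im x))"
      by (simp add: emb_def blinfun.bilinear_simps)
    also have "\<dots> = re x *\<^sub>R emb 0 a0 + emb (- (a0 \<bullet> im x)) (cross3 b0 (im x))"
      using quat_emb[OF so_on_range[OF subspace_quat A]] by (metis re b0 a0_def)
    also have "\<dots> = (qmult \<sigma> ((1/2) *\<^sub>R (a0 + \<sigma> *\<^sub>R b0)) + qmult (- \<sigma>) ((1/2) *\<^sub>R (a0 - \<sigma> *\<^sub>R b0))) x"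
      by (simp add: qmult_apply blinfun.bilinear_simps emb_add emb_scale)
        (simp add: cross3_simps forall_3 s field_simps)
    finally show ?thesis .
  qed
  then show ?thesis by (metis blinfun_eqI)
qed

lemma qmult_ideal:
  assumes \<sigma>: "\<sigma> * \<sigma> = 1"
  shows "lie_ideal (range (qmult \<sigma>)) (so_on quat)"
  unfolding lie_ideal_def
proof (intro conjI ballI)
  show "subspace (range (qmult \<sigma>))"
    by (simp add: linear_subspace_image qmult_linear)
  show "range (qmult \<sigma>) \<subseteq> so_on quat"
    using qmult_so_on by blast
  fix A B assume "A \<in> so_on quat" "B \<in> range (qmult \<sigma>)"
  then obtain a b v where *: "A = qmult \<sigma> a + qmult (- \<sigma>) b" "B = qmult \<sigma> v"
    using so_on_quat_decompose[OF _ \<sigma>] by blast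
  have "bracket (qmult (- \<sigma>) b) (qmult \<sigma> v) = 0"
    using qmult_commute[of "-\<sigma>" b v] \<sigma> by simp
  then show "bracket A B \<in> range (qmult \<sigma>)"
    by (simp add: * bracket_add_left qmult_bracket[OF \<sigma>])
qed

lemma qmult_lie_isomorphic:
  assumes \<sigma>: "\<sigma> * \<sigma> = 1"
  shows "lie_isomorphic (range (qmult \<sigma>)) (so :: ((real^3) \<Rightarrow>\<^sub>L (real^3)) set)"
proof (rule so_isomorphic_cross3[OF qmult_linear qmult_inj])
  show "2 * \<sigma> \<noteq> 0" using \<sigma> by auto
qed (rule qmult_bracket[OF \<sigma>])

lemma qmult_so4_summand:
  assumes \<sigma>: "\<sigma> * \<sigma> = 1"
  shows "so4_summand (range (qmult \<sigma>)) quat"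
proof -
  have \<sigma>': "- \<sigma> * - \<sigma> = 1" using \<sigma> by simp
  have "A = 0" if A: "A \<in> range (qmult \<sigma>)" "A \<in> range (qmult (- \<sigma>))" for A
  proof -
    obtain v w where v: "A = qmult \<sigma> v" and w: "A = qmult (- \<sigma>) w" using A by blast
    \<comment> \<open>An element of both ranges commutes with all of
      \<open>range (qmult \<sigma>)\<close>, so its vector has zero cross product with every
      \<open>u\<close>.\<close>
    have "qmult \<sigma> ((2 * \<sigma>) *\<^sub>R cross3 u v) = qmult \<sigma> 0" for u
      using qmult_bracket[OF \<sigma>, of u v] qmult_commute[OF \<sigma>, of u w] v w
      by (simp add: linear_0[OF qmult_linear])
    then have "cross3 u v = 0" for u
      using qmult_inj \<sigma> by (metis injD mult_eq_0_iff scaleR_eq_0_iff zero_neq_numeral zero_neq_one)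
    then have "cross3 v u = 0" for u using cross_skew[of v u] by simp
    then have "v = 0" using cross_basis_nonzero by blast
    then show ?thesis by (simp add: v linear_0[OF qmult_linear])
  qed
  moreover have "0 \<in> range (qmult s)" for s
    using linear_0[OF qmult_linear] by (metis rangeI)
  ultimately have "range (qmult \<sigma>) \<inter> range (qmult (- \<sigma>)) = {0}" by blast
  moreover have "so_on quat = {A + B | A B. A \<in> range (qmult \<sigma>) \<and> B \<in> range (qmult (- \<sigma>))}"
    using so_on_quat_decompose[OF _ \<sigma>] subspace_add[OF subspace_so_on qmult_so_on qmult_so_on]
    by fastforce
  ultimately show ?thesis
    unfolding so4_summand_def
    using qmult_ideal[OF \<sigma>] qmult_ideal[OF \<sigma>'] qmult_lie_isomorphic[OF \<sigma>] qmult_lie_isomorphic[OF \<sigma>']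
    by blast
qed

text \<open>Bracketing with \<open>qmult \<sigma>\<close> kills the \<open>- \<sigma>\<close>
  component, so the ideal contains pure elements \<open>qmult \<sigma> (cross3 w a)\<close>. The
  rest is simplicity of so(3), made explicit with iterated cross products.\<close>

lemma ideal_contains_qmult_aux:
  assumes \<sigma>: "\<sigma> * \<sigma> = 1" and h: "lie_ideal h (so_on quat)"
    and A: "qmult \<sigma> a + qmult (- \<sigma>) b \<in> h" and a: "a \<noteq> 0"
  shows "range (qmult \<sigma>) \<subseteq> h"
proof -
  have sub: "subspace h" and br: "\<And>B C. B \<in> so_on quat \<Longrightarrow> C \<in> h \<Longrightarrow> bracket B C \<in> h"
    using h by (auto simp: lie_ideal_def)
  define S where "S = {v. qmult \<sigma> v \<in> h}"
  have S: "subspace S"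
    unfolding S_def using sub
    by (simp add: subspace_def linear_0[OF qmult_linear] linear_add[OF qmult_linear] linear_scale[OF qmult_linear])
  \<comment> \<open>The factor \<open>\<sigma> / 2\<close> inverts the structure constant
    \<open>2 * \<sigma>\<close>.\<close>
  have s2: "(2 * \<sigma>) *\<^sub>R (\<sigma> / 2) *\<^sub>R v = v" for v :: "real^3"
    using \<sigma> by (simp add: mult.commute)
  have step: "cross3 w v \<in> S" if "qmult \<sigma> v + qmult (- \<sigma>) b \<in> h" for v w b
  proof -
    have "bracket (qmult \<sigma> ((\<sigma> / 2) *\<^sub>R w)) (qmult \<sigma> v + qmult (- \<sigma>) b) \<in> h"
      by (intro br qmult_so_on that)
    then show ?thesis
      by (simp add: S_def bracket_add_right qmult_commute[OF \<sigma>] qmult_bracket[OF \<sigma>] cross_mult_left s2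
        del: scaleR_scaleR)
  qed
  have double: "cross3 u (cross3 w a) \<in> S" for u w
    using step[of "cross3 w a" 0 u] step[OF A, of w] by (simp add: S_def linear_0[OF qmult_linear])
  \<comment> \<open>The Casimir element of so(3) acts on vectors as -2, which recovers
    \<open>a\<close> itself from double products.\<close>
  have "cross3 (axis 1 1) (cross3 (axis 1 1) a) + cross3 (axis 2 1) (cross3 (axis 2 1) a)
      + cross3 (axis 3 1) (cross3 (axis 3 1) a) \<in> S"
    by (intro subspace_add[OF S] double)
  also have "cross3 (axis 1 1) (cross3 (axis 1 1) a) + cross3 (axis 2 1) (cross3 (axis 2 1) a)
      + cross3 (axis 3 1) (cross3 (axis 3 1) a) = (- 2) *\<^sub>R a"
    by (simp add: vec_eq_iff forall_3 cross_components axis_def)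
  finally have aS: "a \<in> S"
    using subspace_scale[OF S, of "(- 2) *\<^sub>R a" "- 1/2"] by simp
  have "v \<in> S" for v
  proof -
    \<comment> \<open>Lagrange's formula: a \<times> (v \<times> a) = (a \<bullet> a) v - (a
      \<bullet> v) a.\<close>
    have "(1 / (a \<bullet> a)) *\<^sub>R (cross3 a (cross3 v a) + (a \<bullet> v) *\<^sub>R a) \<in> S"
      by (intro subspace_scale[OF S] subspace_add[OF S] double aS)
    also have "(1 / (a \<bullet> a)) *\<^sub>R (cross3 a (cross3 v a) + (a \<bullet> v) *\<^sub>R a) = v"
      using a by (simp add: Lagrange)
    finally show ?thesis .
  qed
  then show ?thesis by (auto simp: S_def)
qed

text \<open>A nonzero element has a nonzero component on one side at least; that side determines
  \<open>\<sigma>\<close>.\<close>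

lemma ideal_contains_qmult:
  assumes h: "lie_ideal h (so_on quat)" and "h \<noteq> {0}"
  shows "\<exists>\<sigma>. \<sigma> * \<sigma> = 1 \<and> range (qmult \<sigma>) \<subseteq> h"
proof -
  have sub: "subspace h" "h \<subseteq> so_on quat" using h by (auto simp: lie_ideal_def)
  then obtain A where A: "A \<in> h" "A \<noteq> 0" using assms(2) subspace_0 by blast
  obtain a b where ab: "A = qmult 1 a + qmult (- 1) b"
    using so_on_quat_decompose[of A 1] A sub by auto
  have "a \<noteq> 0 \<or> b \<noteq> 0"
    using A(2) ab by (auto simp: linear_0[OF qmult_linear])
  then show ?thesis
    using ideal_contains_qmult_aux[of 1 h a b] ideal_contains_qmult_aux[of "- 1" h b a] h A(1) ab
    by (metis add.commute minus_minus mult_minus1 mult_1)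
qed

text \<open>The witness is the imaginary quaternion \<open>j x\<^sup>-\<^sup>1\<close> (or \<open>x\<^sup>-\<^sup>1 j\<close>) with \<open>j = B x\<close>;
  its real part vanishes because \<open>j\<close> is orthogonal to \<open>x\<close>.\<close>

lemma qmult_transitive:
  assumes \<sigma>: "\<sigma> * \<sigma> = 1" and B: "B \<in> so_on quat"
  shows "\<exists>v. qmult \<sigma> v x = B x"
proof (cases "re x = 0 \<and> im x = 0")
  case True
  then have "B x = 0" using so_on_quat_emb[OF B, of x] by (simp add: emb_0)
  then show ?thesis by (intro exI[of _ 0]) (simp add: linear_0[OF qmult_linear])
next
  case False
  define r y p q where "r = re x" and "y = im x" and "p = re (B x)" and "q = im (B x)"
  define n where "n = r * r + y \<bullet> y"
  have n: "n > 0"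
    using False unfolding n_def r_def y_def
    by (metis add_nonneg_eq_0_iff inner_eq_zero_iff inner_ge_zero less_eq_real_def add_nonneg_nonneg mult_eq_0_iff zero_le_square)
  have Bx: "B x = emb p q"
    using quat_emb[OF so_on_range[OF subspace_quat B]] by (simp add: p_def q_def)
  \<comment> \<open>\<open>x\<close> may have a part outside \<open>quat\<close>; skewness is
    applied to its projection \<open>emb r y\<close>, which has the same image under
    \<open>B\<close>.\<close>
  have "B x \<bullet> emb r y = 0"
    using so_inner_self[of B "emb r y"] B so_on_subset so_on_quat_emb[OF B] by (auto simp: r_def y_def)
  then have orth: "q \<bullet> y = - (p * r)" by (simp add: Bx inner_emb)
  \<comment> \<open>The inverse of r + y is (r - y) / n, and this is the imaginary part of (p + q)
    (r - y) / n, with the factors exchanged when \<open>\<sigma> = -1\<close>.\<close>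
  define v where "v = (1/n) *\<^sub>R (r *\<^sub>R q - p *\<^sub>R y - \<sigma> *\<^sub>R cross3 q y)"
  have "v \<bullet> y = (1/n) * (r * (q \<bullet> y) - p * (y \<bullet> y))"
    by (simp add: v_def inner_diff_left dot_cross_self)
  also have "\<dots> = - p * (n / n)" unfolding orth n_def by (simp add: field_simps)
  finally have re: "- (v \<bullet> y) = p" using n by simp
  have "cross3 (cross3 q y) y = (q \<bullet> y) *\<^sub>R y - (y \<bullet> y) *\<^sub>R q"
    by (simp add: cross3_simps forall_3)
  then have K: "cross3 (cross3 q y) y = - ((p * r) *\<^sub>R y) - (y \<bullet> y) *\<^sub>R q"
    by (simp add: orth)
  have \<sigma>': "\<sigma> * (\<sigma> * t) = t" for t using \<sigma> by (simp flip: mult.assoc)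
  have "r *\<^sub>R (r *\<^sub>R q - p *\<^sub>R y - \<sigma> *\<^sub>R cross3 q y) + \<sigma> *\<^sub>R cross3 (r *\<^sub>R q - p *\<^sub>R y - \<sigma> *\<^sub>R cross3 q y) y
      = n *\<^sub>R q"
    by (simp add: \<sigma>' Cross3.left_diff_distrib cross_add_left cross_mult_left K n_def algebra_simps)
  moreover have "r *\<^sub>R v + \<sigma> *\<^sub>R cross3 v y = (1/n) *\<^sub>R
      (r *\<^sub>R (r *\<^sub>R q - p *\<^sub>R y - \<sigma> *\<^sub>R cross3 q y) + \<sigma> *\<^sub>R cross3 (r *\<^sub>R q - p *\<^sub>R y - \<sigma> *\<^sub>R cross3 q y) y)"
    unfolding v_def cross_mult_left scaleR_right_distrib
    by (simp add: mult.commute scaleR_right_diff_distrib)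
  ultimately have im: "r *\<^sub>R v + \<sigma> *\<^sub>R cross3 v y = q"
    using n by simp
  show ?thesis
    using re im by (intro exI[of _ v]) (simp add: qmult_apply Bx flip: r_def y_def)
qed

end

text \<open>Serves two purposes: arbitrary orthonormal bases of a \<open>U i\<close>, and the basis
  \<open>x\<close>, \<open>I x\<close>, \<open>K x\<close>, \<open>L x\<close> adapted to a
  quaternionic structure.\<close>

lemma quaternion_frame_of_orthonormal:
  fixes e a b c :: "'a::euclidean_space"
  assumes "e \<bullet> e = 1" "a \<bullet> a = 1" "b \<bullet> b = 1" "c \<bullet> c = 1"
    "e \<bullet> a = 0" "e \<bullet> b = 0" "e \<bullet> c = 0" "a \<bullet> b = 0" "a \<bullet> c = 0" "b \<bullet> c = 0"
    and \<iota>_def: "\<iota> = (\<lambda>v::real^3. v$1 *\<^sub>R a + v$2 *\<^sub>R b + v$3 *\<^sub>R c)"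
  shows "quaternion_frame e \<iota>" and "quaternion_frame.quat e \<iota> = span {e, a, b, c}"
proof -
  show frame: "quaternion_frame e \<iota>"
  proof (rule quaternion_frame.intro)
    show "linear \<iota>" unfolding \<iota>_def by (rule linearI) (simp_all add: algebra_simps)
  qed (use assms(1-10) in \<open>simp_all add: \<iota>_def inner_simps inner_commute inner_vec_def sum_3\<close>)
  interpret quaternion_frame e \<iota> by (rule frame)
  have emb: "emb r v = r *\<^sub>R e + (v$1 *\<^sub>R a + v$2 *\<^sub>R b + v$3 *\<^sub>R c)" for r v
    unfolding emb_def by (simp add: \<iota>_def)
  show "quat = span {e, a, b, c}"
  proof
    show "quat \<subseteq> span {e, a, b, c}"
      unfolding quat_def emb by (clarify, intro span_add span_scale; simp add: span_base)
    have "emb 1 0 = e" "emb 0 (axis 1 1) = a" "emb 0 (axis 2 1) = b" "emb 0 (axis 3 1) = c"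
      by (simp_all add: emb axis_def)
    then have "{e, a, b, c} \<subseteq> quat"
      using emb_in_quat[of 1 0] emb_in_quat[of 0 "axis 1 1"] emb_in_quat[of 0 "axis 2 1"]
        emb_in_quat[of 0 "axis 3 1"] by simp
    then show "span {e, a, b, c} \<subseteq> quat"
      by (rule span_minimal[OF _ subspace_quat])
  qed
qed

lemma quaternion_frame_exists:
  fixes U :: "'a::euclidean_space set"
  assumes "subspace U" "dim U = 4"
  shows "\<exists>e \<iota>. quaternion_frame e \<iota> \<and> quaternion_frame.quat e \<iota> = U"
proof -
  obtain B where B: "pairwise orthogonal B" "\<And>x. x \<in> B \<Longrightarrow> norm x = 1" "card B = 4" "span B = U"
    using orthonormal_basis_subspace[OF assms(1)] assms(2) by metis
  have "finite B" using B(3) by (intro card_ge_0_finite) simp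
  then obtain xs where xs: "set xs = B" "distinct xs" using finite_distinct_list by blast
  then have "length xs = 4" using B(3) distinct_card by metis
  then obtain e a b c where "xs = [e, a, b, c]"
    by (auto simp: numeral_eq_Suc length_Suc_conv)
  then have D: "B = {e, a, b, c}" "distinct [e, a, b, c]" using xs by auto
  have unit: "e \<bullet> e = 1" "a \<bullet> a = 1" "b \<bullet> b = 1" "c \<bullet> c = 1"
    using B(2) D(1) by (simp_all add: dot_square_norm)
  have orth: "e \<bullet> a = 0" "e \<bullet> b = 0" "e \<bullet> c = 0" "a \<bullet> b = 0" "a \<bullet> c = 0" "b \<bullet> c = 0"
    using B(1) D by (simp_all add: pairwise_def orthogonal_def)
  show ?thesis
    using quaternion_frame_of_orthonormal[OF unit orth refl] B(4) D(1) by blast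
qed

section \<open>Nice subalgebras are of centralizer type\<close>

text \<open>so(2) is a line: on an orthonormal basis \<open>u\<close>, \<open>v\<close> a skew map
  is a multiple of the quarter turn, with factor \<open>v \<bullet> C u\<close>.\<close>

lemma so_on_plane_commute:
  assumes W: "subspace W" "dim W = 2" and A: "A \<in> so_on W" and B: "B \<in> so_on W"
  shows "bracket A B = 0"
proof -
  obtain S where S: "pairwise orthogonal S" "\<And>x. x \<in> S \<Longrightarrow> norm x = 1" "card S = 2" "span S = W"
    using orthonormal_basis_subspace[OF W(1)] W(2) by metis
  then obtain u v where uv: "S = {u, v}" "u \<noteq> v" by (auto simp: card_2_iff)
  have rot: "C u = (v \<bullet> C u) *\<^sub>R v" "C v = - (v \<bullet> C u) *\<^sub>R u" if C: "C \<in> so_on W" for C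
  proof -
    have "C \<in> so" using C so_on_subset by blast
    then have *: "u \<bullet> C u = 0" "v \<bullet> C v = 0" "u \<bullet> C v = - (v \<bullet> C u)"
      using so_inner_self[of C] so_inner[of C u v] by (simp_all add: inner_commute)
    have "(\<Sum>b\<in>S. (C x \<bullet> b) *\<^sub>R b) = C x" for x
      using so_on_range[OF W(1) C] S uv(1) by (intro orthonormal_basis_expand) auto
    then have "(u \<bullet> C x) *\<^sub>R u + (v \<bullet> C x) *\<^sub>R v = C x" for x
      using uv by (simp add: inner_commute)
    from this[of u] this[of v] show "C u = (v \<bullet> C u) *\<^sub>R v" "C v = - (v \<bullet> C u) *\<^sub>R u"
      by (simp_all add: *)
  qed
  define a b where "a = v \<bullet> A u" and "b = v \<bullet> B u"
  have r: "A u = a *\<^sub>R v" "A v = - a *\<^sub>R u" "B u = b *\<^sub>R v" "B v = - b *\<^sub>R u"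
    using rot[OF A] rot[OF B] by (simp_all add: a_def b_def)
  show ?thesis
  proof (rule so_on_eqI[OF W(1) bracket_in_so_on[OF A B]])
    show "0 \<in> so_on W" using subspace_so_on subspace_0 by blast
    fix x assume "x \<in> W"
    then have "x \<in> span S" by (simp add: S)
    then show "bracket A B x = blinfun_apply 0 x"
    proof (rule linear_eq_on_span[rotated 3])
      fix c assume "c \<in> S"
      then show "bracket A B c = blinfun_apply 0 c"
        by (auto simp: uv bracket_apply r blinfun.bilinear_simps)
    qed (auto intro: bounded_linear.linear blinfun.bounded_linear_right)
  qed
qed

lemma orthogonal_sets_sym: "orthogonal_sets S T \<longleftrightarrow> orthogonal_sets T S"
  unfolding orthogonal_sets_def using orthogonal_commute by blast

lemma nice_decompositionD:
  assumes "nice_decomposition p q U W Z"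
  shows "i < p \<Longrightarrow> subspace (U i)" "i < p \<Longrightarrow> dim (U i) = 4"
    "j < q \<Longrightarrow> subspace (W j)" "j < q \<Longrightarrow> dim (W j) = 2"
    "i < p \<Longrightarrow> i' < p \<Longrightarrow> i \<noteq> i' \<Longrightarrow> orthogonal_sets (U i) (U i')"
    "j < q \<Longrightarrow> j' < q \<Longrightarrow> j \<noteq> j' \<Longrightarrow> orthogonal_sets (W j) (W j')"
    "i < p \<Longrightarrow> j < q \<Longrightarrow> orthogonal_sets (U i) (W j)"
    "i < p \<Longrightarrow> j < q \<Longrightarrow> orthogonal_sets (W j) (U i)"
  using assms by (simp_all add: nice_decomposition_def orthogonal_sets_sym)

text \<open>On the left \<open>A\<close> ranges over all of \<open>so_on (U i)\<close>, not just
  \<open>s i\<close>: the matching element sought for the converse comes from the complementary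
  ideal.\<close>

lemma nice_generators_commute:
  assumes dec: "nice_decomposition p q U W Z" and s: "\<And>i. i < p \<Longrightarrow> s i \<subseteq> so_on (U i)"
  shows "i < p \<Longrightarrow> i' < p \<Longrightarrow> i \<noteq> i' \<Longrightarrow> A \<in> so_on (U i) \<Longrightarrow> B \<in> s i' \<Longrightarrow> bracket A B = 0"
    and "i < p \<Longrightarrow> j < q \<Longrightarrow> A \<in> so_on (U i) \<Longrightarrow> B \<in> so_on (W j) \<Longrightarrow> bracket A B = 0"
    and "i < p \<Longrightarrow> j < q \<Longrightarrow> A \<in> so_on (W j) \<Longrightarrow> B \<in> s i \<Longrightarrow> bracket A B = 0"
    and "j < q \<Longrightarrow> j' < q \<Longrightarrow> A \<in> so_on (W j) \<Longrightarrow> B \<in> so_on (W j') \<Longrightarrow> bracket A B = 0"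
proof -
  note D = nice_decompositionD[OF dec]
  show "bracket A B = 0" if "i < p" "i' < p" "i \<noteq> i'" "A \<in> so_on (U i)" "B \<in> s i'"
    using that s[of i'] by (intro so_on_orthogonal_commute[of A "U i" B "U i'"] D) auto
  show "bracket A B = 0" if "i < p" "j < q" "A \<in> so_on (U i)" "B \<in> so_on (W j)"
    using that by (intro so_on_orthogonal_commute[of A "U i" B "W j"] D)
  show "bracket A B = 0" if "i < p" "j < q" "A \<in> so_on (W j)" "B \<in> s i"
    using that s[of i] by (intro so_on_orthogonal_commute[of A "W j" B "U i"] D) auto
  show "bracket A B = 0" if "j < q" "j' < q" "A \<in> so_on (W j)" "B \<in> so_on (W j')"
  proof (cases "j = j'")
    case True
    then show ?thesis using that so_on_plane_commute[OF D(3,4)] by blast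
  next
    case False
    then show ?thesis using that by (intro so_on_orthogonal_commute[of A "W j" B "W j'"] D)
  qed
qed

lemma so4_summandD:
  assumes "so4_summand s U"
  shows "s \<subseteq> so_on U" "A \<in> s \<Longrightarrow> B \<in> s \<Longrightarrow> bracket A B \<in> s"
proof -
  have "lie_ideal s (so_on U)" using assms by (auto simp only: so4_summand_def)
  then show "s \<subseteq> so_on U" "A \<in> s \<Longrightarrow> B \<in> s \<Longrightarrow> bracket A B \<in> s"
    by (auto simp: lie_ideal_def)
qed

text \<open>The content is closure under brackets: those of generators vanish or stay in one
  \<open>s i\<close>, and bilinearity extends this to the span, one argument at a time.\<close>

lemma nice_subalgebra_span:
  assumes dec: "nice_decomposition p q U W Z" and s: "\<And>i. i < p \<Longrightarrow> so4_summand (s i) (U i)"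
  shows "nice_subalgebra (span ((\<Union>i<p. s i) \<union> (\<Union>j<q. so_on (W j))))"
proof -
  define G where "G = (\<Union>i<p. s i) \<union> (\<Union>j<q. so_on (W j))"
  note comm = nice_generators_commute[OF dec so4_summandD(1)[OF s]]
  have "s i \<subseteq> so" if "i < p" for i
    using so4_summandD(1)[OF s[OF that]] so_on_subset by (rule order_trans)
  then have Gso: "G \<subseteq> so"
    unfolding G_def by (simp add: UN_subset_iff so_on_subset)
  have gen: "bracket A B \<in> span G" if "A \<in> G" "B \<in> G" for A B
  proof -
    show ?thesis
      using that unfolding G_def
    proof (elim UnE UN_E)
      fix i i' assume *: "i \<in> {..<p}" "i' \<in> {..<p}" "A \<in> s i" "B \<in> s i'"
      show "bracket A B \<in> span ((\<Union>i<p. s i) \<union> (\<Union>j<q. so_on (W j)))"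
      proof (cases "i = i'")
        case True
        then have "bracket A B \<in> s i" using * so4_summandD(2)[OF s] by blast
        then show ?thesis using * by (auto intro!: span_base)
      next
        case False
        then have "bracket A B = 0" using * comm(1) so4_summandD(1)[OF s] by blast
        then show ?thesis by (simp add: span_zero)
      qed
    next
      fix i j assume *: "i \<in> {..<p}" "j \<in> {..<q}" "A \<in> s i" "B \<in> so_on (W j)"
      then have "bracket A B = 0" using comm(2) so4_summandD(1)[OF s] by blast
      then show "bracket A B \<in> span ((\<Union>i<p. s i) \<union> (\<Union>j<q. so_on (W j)))"
        by (simp add: span_zero)
    next
      fix i j assume *: "i \<in> {..<q}" "j \<in> {..<p}" "A \<in> so_on (W i)" "B \<in> s j"
      then have "bracket A B = 0" using comm(3) by blast
      then show "bracket A B \<in> span ((\<Union>i<p. s i) \<union> (\<Union>j<q. so_on (W j)))"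
        by (simp add: span_zero)
    next
      fix i j assume *: "i \<in> {..<q}" "j \<in> {..<q}" "A \<in> so_on (W i)" "B \<in> so_on (W j)"
      then have "bracket A B = 0" using comm(4) by blast
      then show "bracket A B \<in> span ((\<Union>i<p. s i) \<union> (\<Union>j<q. so_on (W j)))"
        by (simp add: span_zero)
    qed
  qed
  have gen1: "bracket A B \<in> span G" if A: "A \<in> G" and B: "B \<in> span G" for A B
    using B
  proof (induction rule: span_induct)
    case base
    show ?case
      by (simp add: subspace_def bracket_add_right bracket_scaleR_right span_add span_scale span_zero)
  qed (simp add: gen A)
  have "bracket A B \<in> span G" if A: "A \<in> span G" and B: "B \<in> span G" for A B
    using A
  proof (induction rule: span_induct)
    case base
    show ?case
      by (simp add: subspace_def bracket_add_left bracket_scaleR_left span_add span_scale span_zero)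
  qed (simp add: gen1 B)
  then have "lie_subalgebra (span G)" by (simp add: lie_subalgebra_def)
  moreover have "span G \<subseteq> so" using Gso subspace_so by (rule span_minimal)
  ultimately show ?thesis
    unfolding nice_subalgebra_def G_def using dec s by blast
qed

text \<open>The match is taken in the complementary ideal \<open>s'\<close>, which contains a
  transitive family \<open>range (qmult \<sigma>)\<close>. It commutes with \<open>s\<close> because
  brackets of \<open>s'\<close> with \<open>s\<close> lie in both ideals.\<close>

lemma so4_summand_centralized:
  assumes U: "subspace U" "dim U = 4" and s: "so4_summand s U" and J: "J \<in> so_on U"
  shows "\<exists>N\<in>so_on U. blinfun_apply N x = J x \<and> (\<forall>B\<in>s. bracket N B = 0)"
proof -
  obtain s' where s': "lie_ideal s (so_on U)" "lie_ideal s' (so_on U)"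
    "lie_isomorphic s' (so :: ((real^3) \<Rightarrow>\<^sub>L (real^3)) set)" "s \<inter> s' = {0}"
    using s by (auto simp only: so4_summand_def)
  obtain e \<iota> where fr: "quaternion_frame e \<iota>" and U_eq: "quaternion_frame.quat e \<iota> = U"
    using quaternion_frame_exists[OF U] by blast
  interpret quaternion_frame e \<iota> by (rule fr)
  obtain \<sigma> where \<sigma>: "\<sigma> * \<sigma> = 1" "range (qmult \<sigma>) \<subseteq> s'"
    using ideal_contains_qmult[of s'] s'(2) nonzero_if_isomorphic_so3[OF s'(3)] by (auto simp: U_eq)
  obtain v where v: "qmult \<sigma> v x = J x"
    using qmult_transitive[OF \<sigma>(1)] J by (auto simp: U_eq)
  have N: "qmult \<sigma> v \<in> s'" "qmult \<sigma> v \<in> so_on U" using \<sigma>(2) qmult_so_on by (auto simp: U_eq)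
  have "bracket (qmult \<sigma> v) B = 0" if B: "B \<in> s" for B
  proof -
    have "bracket (qmult \<sigma> v) B \<in> s" using s'(1) N(2) B by (auto simp: lie_ideal_def)
    moreover have "bracket B (qmult \<sigma> v) \<in> s'"
      using s'(1,2) N(1) B by (auto simp: lie_ideal_def)
    then have "bracket (qmult \<sigma> v) B \<in> s'"
      using s'(2) subspace_neg unfolding lie_ideal_def by (metis bracket_anticomm)
    ultimately show ?thesis using s'(4) by blast
  qed
  then show ?thesis using v N(2) by blast
qed

lemma nice_subalgebra_imp_centralizer_type:
  assumes "nice_subalgebra f" "V \<subseteq> f"
  shows "centralizer_type V"
proof -
  obtain p q U W Z s where dec: "nice_decomposition p q U W Z"
    and s: "\<And>i. i < p \<Longrightarrow> so4_summand (s i) (U i)"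
    and f: "f = span ((\<Union>i<p. s i) \<union> (\<Union>j<q. so_on (W j)))"
    using assms(1) unfolding nice_subalgebra_def by blast
  define G where "G = (\<Union>i<p. s i) \<union> (\<Union>j<q. so_on (W j))"
  note comm = nice_generators_commute[OF dec so4_summandD(1)[OF s]]
  have gen: "\<exists>N\<in>so. blinfun_apply N x = J x \<and> (\<forall>B\<in>G. bracket N B = 0)" if J: "J \<in> G" for J x
  proof -
    consider i where "i < p" "J \<in> s i" | j where "j < q" "J \<in> so_on (W j)"
      using J by (auto simp: G_def)
    then show ?thesis
    proof cases
      case 1
      have "J \<in> so_on (U i)" using so4_summandD(1)[OF s[OF 1(1)]] 1(2) by blast
      then obtain N where N: "N \<in> so_on (U i)" "N x = J x" "\<And>B. B \<in> s i \<Longrightarrow> bracket N B = 0"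
        using so4_summand_centralized[OF nice_decompositionD(1)[OF dec 1(1)]
            nice_decompositionD(2)[OF dec 1(1)] s[OF 1(1)]] by metis
      have "bracket N B = 0" if "B \<in> G" for B
        using that unfolding G_def
      proof (elim UnE UN_E)
        fix i' assume "i' \<in> {..<p}" "B \<in> s i'"
        then show ?thesis using N(1,3) comm(1)[of i i'] 1 by (cases "i' = i") auto
      next
        fix j assume "j \<in> {..<q}" "B \<in> so_on (W j)"
        then show ?thesis using N(1) comm(2)[of i j] 1 by auto
      qed
      then show ?thesis using N so_on_subset by blast
    next
      case 2
      \<comment> \<open>In a plane summand \<open>J\<close> is its own match, since so(2) is
        abelian.\<close>
      then have "bracket J B = 0" if "B \<in> G" for B
        using that comm(3,4) unfolding G_def by blast
      then show ?thesis using 2 so_on_subset by blast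
    qed
  qed
  have "\<exists>N\<in>centralizer_so V. blinfun_apply N x = J x" if "J \<in> V" for J x
  proof -
    \<comment> \<open>For fixed \<open>x\<close> the matchable \<open>J\<close> form a subspace, so
      matches found for generators add up to matches for all of \<open>f\<close>.\<close>
    define T where "T = {J. \<exists>N\<in>so. blinfun_apply N x = blinfun_apply J x \<and> (\<forall>B\<in>G. bracket N B = 0)}"
    have "subspace T"
      unfolding subspace_def
    proof (intro conjI ballI allI)
      show "0 \<in> T" using subspace_0[OF subspace_so] by (auto simp: T_def intro!: bexI[of _ 0])
    next
      fix A B assume "A \<in> T" "B \<in> T"
      then obtain M N where "M \<in> so" "N \<in> so" "M x = A x" "N x = B x"
        "\<forall>B\<in>G. bracket M B = 0" "\<forall>B\<in>G. bracket N B = 0" by (auto simp: T_def)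
      then show "A + B \<in> T"
        unfolding T_def using subspace_add[OF subspace_so]
        by (auto intro!: bexI[of _ "M + N"] simp: blinfun.bilinear_simps bracket_add_left)
    next
      fix c A assume "A \<in> T"
      then obtain M where "M \<in> so" "M x = A x" "\<forall>B\<in>G. bracket M B = 0" by (auto simp: T_def)
      then show "c *\<^sub>R A \<in> T"
        unfolding T_def using subspace_scale[OF subspace_so]
        by (auto intro!: bexI[of _ "c *\<^sub>R M"] simp: blinfun.bilinear_simps bracket_scaleR_left)
    qed
    moreover have "G \<subseteq> T" using gen by (auto simp: T_def)
    ultimately have "span G \<subseteq> T" by (simp add: span_minimal)
    then have "J \<in> T" using that assms(2) f by (auto simp: G_def)
    then obtain N where N: "N \<in> so" "N x = J x" "\<And>B. B \<in> G \<Longrightarrow> bracket N B = 0"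
      by (auto simp: T_def)
    have "subspace {B. bracket N B = 0}"
      by (simp add: subspace_def bracket_add_right bracket_scaleR_right)
    then have "span G \<subseteq> {B. bracket N B = 0}" using N(3) by (intro span_minimal) auto
    then have "N \<in> centralizer_so V"
      using N(1) assms(2) f by (auto simp: centralizer_so_def G_def)
    then show ?thesis using N(2) by blast
  qed
  then show ?thesis by (simp add: centralizer_type_def)
qed

section \<open>Irreducible subspaces\<close>

definition invariant_under :: "('a::euclidean_space \<Rightarrow>\<^sub>L 'a) set \<Rightarrow> 'a set \<Rightarrow> bool" where
  "invariant_under V E \<longleftrightarrow> subspace E \<and> (\<forall>J\<in>V. \<forall>x\<in>E. blinfun_apply J x \<in> E)"

definition irreducible_under :: "('a::euclidean_space \<Rightarrow>\<^sub>L 'a) set \<Rightarrow> 'a set \<Rightarrow> bool" where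
  "irreducible_under V E \<longleftrightarrow> invariant_under V E \<and> E \<noteq> {0} \<and>
     (\<forall>F. invariant_under V F \<and> F \<subseteq> E \<and> F \<noteq> {0} \<longrightarrow> F = E)"

lemma irreducible_under_eq:
  assumes "irreducible_under V E" "invariant_under V F" "F \<subseteq> E" "x \<in> F" "x \<noteq> 0"
  shows "F = E"
  using assms unfolding irreducible_under_def by blast

lemma orthogonal_irreducible_decomposition:
  fixes V :: "('a::euclidean_space \<Rightarrow>\<^sub>L 'a) set"
  assumes "V \<subseteq> so" "invariant_under V S"
  shows "\<exists>\<E>. finite \<E> \<and> (\<forall>E\<in>\<E>. irreducible_under V E) \<and> pairwise orthogonal_sets \<E> \<and> span (\<Union>\<E>) = S"
  using assms(2)
proof (induction "dim S" arbitrary: S rule: less_induct)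
  case less
  have S: "subspace S" using less.prems by (simp add: invariant_under_def)
  show ?case
  proof (cases "S = {0}")
    case True
    then show ?thesis by (intro exI[of _ "{}"]) auto
  next
    case False
    \<comment> \<open>Minimal dimension among nonzero invariant subspaces forces irreducibility;
      induction then continues on the complement of \<open>E\<close> in \<open>S\<close>.\<close>
    obtain E where E: "invariant_under V E" "E \<subseteq> S" "E \<noteq> {0}"
      and min: "\<And>F. invariant_under V F \<Longrightarrow> F \<subseteq> S \<Longrightarrow> F \<noteq> {0} \<Longrightarrow> dim E \<le> dim F"
      using ex_has_least_nat[of "\<lambda>F. invariant_under V F \<and> F \<subseteq> S \<and> F \<noteq> {0}" S dim] less.prems False
      by blast
    have Es: "subspace E" using E(1) by (simp add: invariant_under_def)
    have irr: "irreducible_under V E"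
      unfolding irreducible_under_def
    proof (intro conjI allI impI E)
      fix F assume F: "invariant_under V F \<and> F \<subseteq> E \<and> F \<noteq> {0}"
      then have "dim E \<le> dim F" using min E(2) by blast
      then show "F = E" using F Es by (simp add: invariant_under_def subspace_dim_equal)
    qed
    define S' where "S' = {y \<in> S. \<forall>x\<in>E. orthogonal x y}"
    have inv: "invariant_under V S'"
      unfolding invariant_under_def
    proof (intro conjI ballI)
      have "S' = S \<inter> {y. \<forall>x\<in>E. orthogonal x y}" by (auto simp: S'_def)
      then show S': "subspace S'"
        using subspace_inter[OF S subspace_orthogonal_to_vectors] by simp
      fix J y assume J: "J \<in> V" and y: "y \<in> S'"
      have "orthogonal x (J y)" if "x \<in> E" for x
      proof -
        have "J x \<in> E" using E(1) J that by (simp add: invariant_under_def)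
        then have "J x \<bullet> y = 0" using y by (simp add: S'_def orthogonal_def)
        then show ?thesis using so_inner[of J x y] J assms(1) by (auto simp: orthogonal_def)
      qed
      then show "J y \<in> S'" using y J less.prems by (simp add: S'_def invariant_under_def)
    qed
    have "dim S' + dim E = dim S"
      unfolding S'_def by (rule dim_subspace_orthogonal_to_vectors[OF Es S E(2)])
    moreover have "dim E \<noteq> 0"
      using E(3) subspace_0[OF Es] by auto
    ultimately have "dim S' < dim S" by linarith
    from less.hyps[OF this inv] obtain \<E> where \<E>: "finite \<E>" "\<And>E. E \<in> \<E> \<Longrightarrow> irreducible_under V E"
      "pairwise orthogonal_sets \<E>" "span (\<Union>\<E>) = S'"
      by blast
    have orth: "orthogonal x y" if "x \<in> E" "y \<in> F" "F \<in> \<E>" for x y F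
    proof -
      have "y \<in> S'" using that \<E>(4) span_base[of y "\<Union>\<E>"] by auto
      then show ?thesis using that(1) by (simp add: S'_def)
    qed
    have "S \<subseteq> span (\<Union>(insert E \<E>))"
    proof
      fix x assume x: "x \<in> S"
      have P: "proj E x \<in> E" by (rule proj_in[OF Es])
      have "x - proj E x \<in> S'"
        using x P E(2) S proj_diff_orthogonal[OF Es] by (auto simp: S'_def subspace_diff)
      then have "x - proj E x \<in> span (\<Union>(insert E \<E>))"
        using \<E>(4) span_mono[of "\<Union>\<E>" "\<Union>(insert E \<E>)"] by auto
      moreover have "proj E x \<in> span (\<Union>(insert E \<E>))"
        using P by (intro span_base) auto
      ultimately have "(x - proj E x) + proj E x \<in> span (\<Union>(insert E \<E>))"
        by (rule span_add)
      then show "x \<in> span (\<Union>(insert E \<E>))" by simp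
    qed
    moreover have "\<Union>(insert E \<E>) \<subseteq> S"
      using E(2) \<E>(4) span_superset[of "\<Union>\<E>"] by (auto simp: S'_def)
    then have "span (\<Union>(insert E \<E>)) \<subseteq> S"
      using S by (rule span_minimal)
    moreover have "pairwise orthogonal_sets (insert E \<E>)"
    proof -
      have "orthogonal_sets E F" "orthogonal_sets F E" if "F \<in> \<E>" for F
        using orth that by (auto simp: orthogonal_sets_def intro: orthogonal_commute[THEN iffD1])
      then show ?thesis using \<E>(3) by (simp add: pairwise_insert)
    qed
    ultimately show ?thesis
      using \<E>(1,2) irr by (intro exI[of _ "insert E \<E>"]) auto
  qed
qed

text \<open>Schur's lemma for the symmetric operator \<open>- N\<^sup>2\<close>: the minimum of \<open>|N x|\<^sup>2\<close> on the
  unit sphere of \<open>E\<close> is an eigenvalue, and its eigenspace is invariant.\<close>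

lemma schur_skew_square:
  assumes irr: "irreducible_under V E" and N: "N \<in> so_on E"
    and comm: "\<And>J. J \<in> V \<Longrightarrow> bracket N J = 0"
  shows "\<exists>c. \<forall>x\<in>E. N (N x) = - c *\<^sub>R x"
proof -
  have E: "subspace E" "E \<noteq> {0}" and inv: "invariant_under V E"
    using irr by (auto simp: irreducible_under_def invariant_under_def)
  have Nso: "N \<in> so" using N so_on_subset by blast
  obtain w where w: "w \<in> E" "w \<noteq> 0" using E subspace_0 by blast
  have "compact (E \<inter> sphere 0 1)"
    using closed_subspace[OF E(1)] by (simp add: closed_Int_compact)
  moreover have "(1 / norm w) *\<^sub>R w \<in> E \<inter> sphere 0 1"
    using w E(1) by (simp add: subspace_scale)
  ultimately obtain x0 where x0: "x0 \<in> E" "norm x0 = 1"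
    and min: "\<And>y. y \<in> E \<Longrightarrow> norm y = 1 \<Longrightarrow> N x0 \<bullet> N x0 \<le> N y \<bullet> N y"
    using continuous_attains_inf[of "E \<inter> sphere 0 1" "\<lambda>x. N x \<bullet> N x"]
    by (force intro!: continuous_intros)
  define c where "c = N x0 \<bullet> N x0"
  have bound: "c * (y \<bullet> y) \<le> N y \<bullet> N y" if "y \<in> E" for y
  proof (cases "y = 0")
    case False
    have "c \<le> N ((1 / norm y) *\<^sub>R y) \<bullet> N ((1 / norm y) *\<^sub>R y)"
      unfolding c_def using that False E(1) by (intro min) (auto simp: subspace_scale)
    also have "\<dots> = (N y \<bullet> N y) / (y \<bullet> y)"
      by (simp add: blinfun.bilinear_simps dot_square_norm power2_eq_square)
    finally show ?thesis using False by (simp add: field_simps)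
  qed simp
  \<comment> \<open>Up to a factor, the negative gradient at the minimizer \<open>x0\<close> of the
    nonnegative form |N y|^2 - c |y|^2, which vanishes there.\<close>
  define z where "z = N (N x0) + c *\<^sub>R x0"
  have z: "z \<in> E"
    unfolding z_def using x0(1) E(1) so_on_range[OF E(1) N] by (simp add: subspace_add subspace_scale)
  define d where "d = N z \<bullet> N z - c * (z \<bullet> z)"
  have d: "d \<ge> 0" using bound[OF z] by (simp add: d_def)
  \<comment> \<open>The form evaluated at \<open>x0 + t *\<^sub>R z\<close>; a linear term with
    nonzero coefficient would make it negative for small positive \<open>t\<close>.\<close>
  have quad: "0 \<le> t * t * d - 2 * t * (z \<bullet> z)" for t
  proof -
    have "c * ((x0 + t *\<^sub>R z) \<bullet> (x0 + t *\<^sub>R z)) \<le> N (x0 + t *\<^sub>R z) \<bullet> N (x0 + t *\<^sub>R z)"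
      using x0(1) z E(1) by (intro bound) (simp add: subspace_add subspace_scale)
    moreover have "N x0 \<bullet> N z = - (z \<bullet> z) + c * (x0 \<bullet> z)"
    proof -
      have "N (N x0) = z - c *\<^sub>R x0" by (simp add: z_def)
      then show ?thesis using so_inner[OF Nso, of "N x0" z] by (simp add: inner_simps)
    qed
    moreover have "x0 \<bullet> x0 = 1" using x0(2) by (simp add: dot_square_norm)
    ultimately show ?thesis
      by (simp add: d_def blinfun.bilinear_simps inner_simps inner_commute c_def[symmetric] algebra_simps)
  qed
  have "z = 0"
  proof (rule ccontr)
    assume "z \<noteq> 0"
    \<comment> \<open>Small enough that \<open>t * d\<close> is at most
      \<open>z \<bullet> z\<close>; the summand 1 covers \<open>d = 0\<close>.\<close>
    define t where "t = (z \<bullet> z) / (d + 1)"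
    have t: "t > 0" using \<open>z \<noteq> 0\<close> d by (simp add: t_def)
    have "t * d \<le> z \<bullet> z"
      using d by (simp add: t_def divide_le_eq mult_left_mono algebra_simps)
    moreover have "z \<bullet> z > 0" using \<open>z \<noteq> 0\<close> by simp
    ultimately have "t * (t * d - 2 * (z \<bullet> z)) < 0"
      using t by (intro mult_pos_neg) linarith+
    then show False using quad[of t] by (simp add: algebra_simps)
  qed
  define F where "F = {y \<in> E. N (N y) = - c *\<^sub>R y}"
  have "invariant_under V F"
    unfolding invariant_under_def
  proof (intro conjI ballI)
    show "subspace F"
      using E(1) by (auto simp: subspace_def F_def blinfun.bilinear_simps scaleR_right_distrib)
    fix J y assume "J \<in> V" "y \<in> F"
    moreover from this have "N (J x) = J (N x)" for x
      using comm by (simp add: bracket_eq_0_iff)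
    ultimately show "J y \<in> F"
      using inv by (simp add: F_def invariant_under_def blinfun.bilinear_simps)
  qed
  moreover have "x0 \<in> F"
    using \<open>z = 0\<close> x0(1) by (simp add: F_def z_def eq_neg_iff_add_eq_0)
  moreover have "x0 \<noteq> 0" using x0(2) by auto
  moreover have "F \<subseteq> E" by (auto simp: F_def)
  ultimately have "F = E" using irreducible_under_eq[OF irr] by metis
  then show ?thesis by (auto simp: F_def)
qed

section \<open>The commutant of V on one irreducible subspace\<close>

locale centralized_irreducible =
  fixes V :: "('a::euclidean_space \<Rightarrow>\<^sub>L 'a) set" and E :: "'a set"
  assumes V_so: "V \<subseteq> so" and centralizer: "centralizer_type V" and irr: "irreducible_under V E"
begin

text \<open>Elements are extended by zero outside \<open>E\<close>, so that brackets with
  \<open>V\<close> and membership in \<open>so\<close> refer to the whole space.\<close>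

definition C :: "('a \<Rightarrow>\<^sub>L 'a) set" where
  "C = {N \<in> so_on E. \<forall>J\<in>V. bracket N J = 0}"

lemma subspace_E: "subspace E"
  and E_nonzero: "E \<noteq> {0}"
  and V_E: "J \<in> V \<Longrightarrow> x \<in> E \<Longrightarrow> J x \<in> E"
  using irr by (auto simp: irreducible_under_def invariant_under_def)

lemma C_so_on: "N \<in> C \<Longrightarrow> N \<in> so_on E"
  by (simp add: C_def)

lemma C_so: "N \<in> C \<Longrightarrow> N \<in> so"
  using C_so_on so_on_subset by blast

lemma C_in_E: "N \<in> C \<Longrightarrow> N x \<in> E"
  using so_on_range[OF subspace_E C_so_on] .

lemma C_commute: "N \<in> C \<Longrightarrow> J \<in> V \<Longrightarrow> N (J x) = J (N x)"
  by (simp add: C_def bracket_eq_0_iff)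

lemma subspace_C: "subspace C"
  using subspace_so_on[of E]
  by (auto simp: subspace_def C_def bracket_add_left bracket_scaleR_left)

lemma bracket_in_C:
  assumes "M \<in> C" "N \<in> C"
  shows "bracket M N \<in> C"
proof -
  have "bracket (bracket M N) J = 0" if "J \<in> V" for J
    using assms that by (simp add: bracket_eq_0_iff bracket_apply C_commute blinfun.bilinear_simps)
  then show ?thesis using assms bracket_in_so_on by (auto simp: C_def)
qed

lemma C_eqI: "M \<in> C \<Longrightarrow> N \<in> C \<Longrightarrow> (\<And>x. x \<in> E \<Longrightarrow> M x = N x) \<Longrightarrow> M = N"
  using so_on_eqI[OF subspace_E C_so_on C_so_on] .

lemma proj_E_commute: "J \<in> V \<Longrightarrow> proj E (J x) = J (proj E x)"
  using so_invariant_proj_commute[OF subspace_E] V_so V_E by blast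

text \<open>Compressing the centralizing \<open>N\<close> to \<open>E\<close> keeps it commuting
  with \<open>V\<close>, because \<open>proj E\<close> does, and keeps its value at
  \<open>x\<close>, because \<open>J x\<close> lies in \<open>E\<close>.\<close>

lemma C_realizes:
  assumes "J \<in> V" "x \<in> E"
  shows "\<exists>N\<in>C. blinfun_apply N x = J x"
proof -
  obtain N where N: "N \<in> centralizer_so V" "N x = J x"
    using centralizer assms(1) unfolding centralizer_type_def by blast
  then have Nso: "N \<in> so" and NV: "\<And>K y. K \<in> V \<Longrightarrow> N (K y) = K (N y)"
    by (auto simp: centralizer_so_def bracket_eq_0_iff)
  define M where "M = proj E o\<^sub>L N o\<^sub>L proj E"
  have "bracket M K = 0" if "K \<in> V" for K
    using that by (simp add: bracket_eq_0_iff M_def proj_E_commute NV)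
  then have "M \<in> C"
    using proj_compress_so_on[OF subspace_E Nso] by (simp add: C_def M_def)
  moreover have "M x = J x"
    using assms N(2) by (simp add: M_def proj_id[OF subspace_E] V_E)
  ultimately show ?thesis by blast
qed

lemma C_square: "N \<in> C \<Longrightarrow> \<exists>c. \<forall>x\<in>E. N (N x) = - c *\<^sub>R x"
  using schur_skew_square[OF irr] by (simp add: C_def)

text \<open>Polarization of \<open>C_square\<close>, applied to \<open>M + N\<close>.\<close>

lemma C_anticommutator:
  assumes "M \<in> C" "N \<in> C"
  shows "\<exists>c. \<forall>x\<in>E. M (N x) + N (M x) = c *\<^sub>R x"
proof -
  have "M + N \<in> C" using assms subspace_C by (simp add: subspace_add)
  then obtain a b c where "\<forall>x\<in>E. (M + N) ((M + N) x) = - a *\<^sub>R x"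
    "\<forall>x\<in>E. M (M x) = - b *\<^sub>R x" "\<forall>x\<in>E. N (N x) = - c *\<^sub>R x"
    using C_square assms by meson
  then have "\<forall>x\<in>E. M (N x) + N (M x) = (b + c - a) *\<^sub>R x"
    by (simp add: blinfun.bilinear_simps algebra_simps)
  then show ?thesis by blast
qed

text \<open>Skewness gives |N x|^2 = c |x|^2, hence c > 0 and scaling by 1 / sqrt c yields a complex
  structure on \<open>E\<close>.\<close>

lemma C_normalize:
  assumes "N \<in> C" "N \<noteq> 0"
  shows "\<exists>r. r \<noteq> 0 \<and> (\<forall>x\<in>E. (r *\<^sub>R N) ((r *\<^sub>R N) x) = - x)"
proof -
  obtain c where c: "\<And>x. x \<in> E \<Longrightarrow> N (N x) = - c *\<^sub>R x" using C_square[OF assms(1)] by blast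
  have "0 \<in> C" using subspace_C subspace_0 by blast
  then obtain x where x: "x \<in> E" "N x \<noteq> 0"
    using C_eqI[OF assms(1), of 0] assms(2) by auto
  have "N x \<bullet> N x = c * (x \<bullet> x)"
    using so_inner[OF C_so[OF assms(1)], of x "N x"] c[OF x(1)] by simp
  moreover have "N x \<bullet> N x > 0" "x \<bullet> x \<ge> 0" using x by simp_all
  ultimately have "c > 0" by (metis mult_nonpos_nonneg not_le)
  define r where "r = 1 / sqrt c"
  have "r * (r * c) = 1" "r \<noteq> 0" using \<open>c > 0\<close> by (simp_all add: r_def)
  then have "(r *\<^sub>R N) ((r *\<^sub>R N) x) = - x" if "x \<in> E" for x
    using c[OF that] by (simp add: blinfun.bilinear_simps)
  then show ?thesis using \<open>r \<noteq> 0\<close> by blast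
qed

text \<open>For \<open>J x = M x\<close> with \<open>M \<in> C\<close>, the symmetric part of \<open>N M\<close> is a scalar and its skew
  part lies in \<open>C\<close>; hence \<open>\<real> x + C x\<close> is invariant under \<open>V\<close>.\<close>

lemma E_generated:
  assumes x: "x \<in> E" "x \<noteq> 0" and y: "y \<in> E"
  shows "\<exists>r. \<exists>N\<in>C. y = r *\<^sub>R x + N x"
proof -
  define F where "F = {r *\<^sub>R x + blinfun_apply N x | r N. N \<in> C}"
  have F: "subspace F"
    unfolding subspace_def
  proof (intro conjI ballI allI)
    show "0 \<in> F" using subspace_0[OF subspace_C] unfolding F_def by force
  next
    fix a b assume "a \<in> F" "b \<in> F"
    then obtain r M s N where "a = r *\<^sub>R x + blinfun_apply M x" "b = s *\<^sub>R x + blinfun_apply N x" "M \<in> C" "N \<in> C"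
      by (auto simp: F_def)
    then have "a + b = (r + s) *\<^sub>R x + blinfun_apply (M + N) x" "M + N \<in> C"
      using subspace_C by (simp_all add: subspace_add blinfun.bilinear_simps algebra_simps)
    then show "a + b \<in> F" unfolding F_def by blast
  next
    fix c a assume "a \<in> F"
    then obtain r M where "a = r *\<^sub>R x + blinfun_apply M x" "M \<in> C"
      by (auto simp: F_def)
    then have "c *\<^sub>R a = (c * r) *\<^sub>R x + blinfun_apply (c *\<^sub>R M) x" "c *\<^sub>R M \<in> C"
      using subspace_C by (simp_all add: subspace_scale blinfun.bilinear_simps algebra_simps)
    then show "c *\<^sub>R a \<in> F" unfolding F_def by blast
  qed
  have "invariant_under V F"
    unfolding invariant_under_def
  proof (intro conjI ballI F)
    fix J y assume J: "J \<in> V" and "y \<in> F"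
    then obtain r N where y: "y = r *\<^sub>R x + blinfun_apply N x" "N \<in> C" by (auto simp: F_def)
    obtain M where M: "M \<in> C" "M x = J x" using C_realizes[OF J x(1)] by blast
    obtain c where c: "N (M x) + M (N x) = c *\<^sub>R x"
      using C_anticommutator[OF y(2) M(1)] x(1) by blast
    define K where "K = r *\<^sub>R M + (1/2) *\<^sub>R bracket N M"
    have "K \<in> C"
      unfolding K_def using subspace_C M(1) bracket_in_C[OF y(2) M(1)]
      by (simp add: subspace_add subspace_scale)
    have "J y = r *\<^sub>R M x + N (M x)"
      using y M J by (simp add: blinfun.bilinear_simps C_commute)
    also have "N (M x) = (1/2) *\<^sub>R (N (M x) + M (N x)) + (1/2) *\<^sub>R bracket N M x"
      by (simp add: bracket_apply algebra_simps flip: scaleR_left.add)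
    also have "r *\<^sub>R M x + \<dots> = (c/2) *\<^sub>R x + K x"
      by (simp add: c K_def blinfun.bilinear_simps)
    finally show "J y \<in> F" using \<open>K \<in> C\<close> unfolding F_def by blast
  qed
  moreover have "F \<subseteq> E"
    using subspace_E x(1) C_in_E by (auto simp: F_def subspace_add subspace_scale)
  moreover have "x = 1 *\<^sub>R x + blinfun_apply 0 x" by simp
  then have "x \<in> F" using subspace_0[OF subspace_C] unfolding F_def by blast
  ultimately have "F = E" using irreducible_under_eq[OF irr] x(2) by metis
  then have "y \<in> F" using y by simp
  then show ?thesis unfolding F_def by blast
qed

lemma unit_exists: "\<exists>x\<in>E. x \<bullet> x = 1"
proof -
  obtain x where x: "x \<in> E" "x \<noteq> 0" using E_nonzero subspace_0[OF subspace_E] by blast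
  then have "(1 / norm x) *\<^sub>R x \<in> E" using subspace_E by (simp add: subspace_scale)
  moreover have "((1 / norm x) *\<^sub>R x) \<bullet> ((1 / norm x) *\<^sub>R x) = 1"
    using x(2) by (simp add: dot_square_norm power2_eq_square)
  ultimately show ?thesis by blast
qed

lemma dim_eq_1_if_C_trivial:
  assumes "C = {0}"
  shows "dim E = 1" and "J \<in> V \<Longrightarrow> x \<in> E \<Longrightarrow> J x = 0"
proof -
  obtain x where x: "x \<in> E" "x \<noteq> 0" using unit_exists by force
  have "E \<subseteq> span {x}"
    using E_generated[OF x] assms by (auto simp: span_singleton)
  moreover have "span {x} \<subseteq> E" using x(1) subspace_E by (simp add: span_minimal)
  ultimately have "E = span {x}" by blast
  moreover have "independent {x}" using x(2) by simp
  ultimately show "dim E = 1" using dim_span_eq_card_independent[of "{x}"] by simp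
  show "J x = 0" if "J \<in> V" "x \<in> E" for J x
    using C_realizes[OF that] assms by auto
qed

lemma dim_eq_2_if_C_line:
  assumes I: "I \<in> C" "\<And>x. x \<in> E \<Longrightarrow> I (I x) = - x" and line: "C \<subseteq> span {I}"
  shows "dim E = 2"
proof -
  obtain x where x: "x \<in> E" "x \<bullet> x = 1" using unit_exists by blast
  then have x0: "x \<noteq> 0" by auto
  have Ix: "I x \<noteq> 0" using I(2)[OF x(1)] x0 by auto
  have "E \<subseteq> span {x, I x}"
  proof
    fix y assume "y \<in> E"
    then obtain r N where y: "y = r *\<^sub>R x + blinfun_apply N x" "N \<in> C"
      using E_generated[OF x(1) x0] by blast
    then obtain c where "N = c *\<^sub>R I" using line by (auto simp: span_singleton)
    then have "y = r *\<^sub>R x + c *\<^sub>R I x" using y by (simp add: blinfun.bilinear_simps)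
    then show "y \<in> span {x, I x}" by (simp add: span_add span_scale span_base)
  qed
  moreover have "span {x, I x} \<subseteq> E"
    using x(1) C_in_E[OF I(1)] subspace_E by (simp add: span_minimal)
  ultimately have E: "E = span {x, I x}" by blast
  have orth: "I x \<bullet> x = 0" using so_inner_self C_so I(1) by blast
  then have "pairwise orthogonal {x, I x}"
    by (simp add: pairwise_insert orthogonal_def inner_commute)
  then have "independent {x, I x}"
    using x0 Ix by (intro pairwise_orthogonal_independent) auto
  moreover have "x \<noteq> I x" using orth x(2) by auto
  ultimately show ?thesis using E dim_span_eq_card_independent[of "{x, I x}"] by simp
qed

lemma anticommuting_exists:
  assumes I: "I \<in> C" "\<And>x. x \<in> E \<Longrightarrow> I (I x) = - x" and "\<not> C \<subseteq> span {I}"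
  shows "\<exists>K\<in>C. \<forall>x\<in>E. blinfun_apply K (K x) = - x \<and> I (K x) = - K (I x)"
proof -
  obtain N where N: "N \<in> C" "N \<notin> span {I}" using assms(3) by blast
  obtain c where c: "\<And>x. x \<in> E \<Longrightarrow> I (N x) + N (I x) = c *\<^sub>R x"
    using C_anticommutator[OF I(1) N(1)] by blast
  \<comment> \<open>A Gram-Schmidt step for the anticommutator: as I^2 = -1 on \<open>E\<close>,
    adding (c/2) I cancels the scalar \<open>c\<close>.\<close>
  define M where "M = N + (c/2) *\<^sub>R I"
  have M: "M \<in> C" unfolding M_def using subspace_C N(1) I(1) by (simp add: subspace_add subspace_scale)
  have "M \<noteq> 0"
  proof
    assume "M = 0"
    then have "N = (- c/2) *\<^sub>R I" by (simp add: M_def add_eq_0_iff)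
    then have "N \<in> span {I}" by (simp only: span_scale span_base insertI1)
    then show False using N(2) by simp
  qed
  then obtain r where r: "r \<noteq> 0" "\<And>x. x \<in> E \<Longrightarrow> (r *\<^sub>R M) ((r *\<^sub>R M) x) = - x"
    using C_normalize[OF M] by blast
  have "I (M x) + M (I x) = 0" if "x \<in> E" for x
  proof -
    have "I (M x) + M (I x) = (I (N x) + N (I x)) + c *\<^sub>R I (I x)"
      by (simp add: M_def blinfun.bilinear_simps algebra_simps flip: scaleR_left.add)
    also have "\<dots> = 0" using c[OF that] I(2)[OF that] by simp
    finally show ?thesis .
  qed
  then have "I ((r *\<^sub>R M) x) = - (r *\<^sub>R M) (I x)" if "x \<in> E" for x
    using that by (simp add: blinfun.bilinear_simps add_eq_0_iff)
  moreover have "r *\<^sub>R M \<in> C" using M subspace_C by (simp add: subspace_scale)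
  ultimately show ?thesis using r(2) by blast
qed

lemma quaternionic_case:
  assumes I: "I \<in> C" "\<And>x. x \<in> E \<Longrightarrow> I (I x) = - x"
    and K: "K \<in> C" "\<And>x. x \<in> E \<Longrightarrow> K (K x) = - x"
    and IK: "\<And>x. x \<in> E \<Longrightarrow> K (I x) = - I (K x)"
  shows "dim E = 4 \<and> (\<exists>s. so4_summand s E \<and> (\<forall>J\<in>V. J o\<^sub>L proj E \<in> s))"
proof -
  \<comment> \<open>On \<open>E\<close> this is the product I K, as \<open>I\<close> and
    \<open>K\<close> anticommute there; written as a bracket it visibly lies in
    \<open>C\<close>.\<close>
  define L where "L = (1/2) *\<^sub>R bracket I K"
  have L: "L \<in> C" unfolding L_def using bracket_in_C[OF I(1) K(1)] subspace_C by (simp add: subspace_scale)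
  have Lx: "L x = I (K x)" if "x \<in> E" for x
    using IK[OF that] by (simp add: L_def blinfun.bilinear_simps bracket_apply flip: scaleR_2)
  note inE = C_in_E[OF I(1)] C_in_E[OF K(1)] C_in_E[OF L]
  have LI: "L (I x) = K x" and IL: "I (L x) = - K x" and LK: "L (K x) = - I x" and KL: "K (L x) = I x"
    and LL: "L (L x) = - x" if "x \<in> E" for x
    using that by (simp_all add: Lx IK I(2) K(2) inE blinfun.bilinear_simps)
  have C_span: "\<exists>a b c. N = a *\<^sub>R I + b *\<^sub>R K + c *\<^sub>R L" if N: "N \<in> C" for N
  proof -
    obtain a b c where a: "\<And>x. x \<in> E \<Longrightarrow> N (I x) + I (N x) = a *\<^sub>R x"
      and b: "\<And>x. x \<in> E \<Longrightarrow> N (K x) + K (N x) = b *\<^sub>R x"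
      and c: "\<And>x. x \<in> E \<Longrightarrow> N (L x) + L (N x) = c *\<^sub>R x"
      using C_anticommutator[OF N] I(1) K(1) L by meson
    \<comment> \<open>Removes the components of \<open>N\<close> along \<open>I\<close>,
      \<open>K\<close> and \<open>L\<close>, so \<open>M\<close> anticommutes with all three on
      \<open>E\<close>.\<close>
    define M where "M = N + (a/2) *\<^sub>R I + (b/2) *\<^sub>R K + (c/2) *\<^sub>R L"
    have M: "M \<in> C"
      unfolding M_def using subspace_C N I(1) K(1) L by (simp add: subspace_add subspace_scale)
    have M_I: "M (I x) = - I (M x)" and M_K: "M (K x) = - K (M x)" and M_L: "M (L x) = - L (M x)" if "x \<in> E" for x
      using a[OF that] b[OF that] c[OF that]
      by (simp_all add: M_def blinfun.bilinear_simps that I(2) K(2) IK LI IL LK KL LL Lx[symmetric]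
          add_eq_0_iff eq_neg_iff_add_eq_0 algebra_simps flip: scaleR_left.add)
    have "M x = 0" if x: "x \<in> E" for x
    proof -
      have Mx: "M x \<in> E" by (rule C_in_E[OF M])
      \<comment> \<open>Anticommuting with \<open>I\<close> and with \<open>K\<close> means
        commuting with their product \<open>L\<close>; together with \<open>M_L\<close> this leaves
        \<open>M = 0\<close>.\<close>
      have "M (L x) = L (M x)"
        using x Mx inE by (simp add: Lx M_I M_K blinfun.bilinear_simps)
      then have "L (M x) + L (M x) = 0" using M_L[OF x] by (metis add.left_inverse)
      then have "L (M x) = 0" by (simp flip: scaleR_2)
      then show ?thesis using LL[OF Mx] by simp
    qed
    then have "M = 0"
      using C_eqI[OF M] subspace_0[OF subspace_C] by simp
    moreover have "N = M + ((- a/2) *\<^sub>R I + (- b/2) *\<^sub>R K + (- c/2) *\<^sub>R L)"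
      by (simp add: M_def)
    ultimately have "N = (- a/2) *\<^sub>R I + (- b/2) *\<^sub>R K + (- c/2) *\<^sub>R L" by simp
    then show ?thesis by blast
  qed
  obtain x where x: "x \<in> E" "x \<bullet> x = 1" using unit_exists by blast
  then have x0: "x \<noteq> 0" by auto
  have iso: "N x \<bullet> N x = 1" if "N \<in> C" "N (N x) = - x" for N
    using so_inner[OF C_so[OF that(1)], of x "N x"] that(2) x(2) by simp
  have norms: "I x \<bullet> I x = 1" "K x \<bullet> K x = 1" "L x \<bullet> L x = 1"
    using iso I K L LL x(1) by blast+
  have sx: "x \<bullet> I x = 0" "x \<bullet> K x = 0" "x \<bullet> L x = 0"
    using so_inner_self[OF C_so[OF I(1)]] so_inner_self[OF C_so[OF K(1)]] so_inner_self[OF C_so[OF L]]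
    by (simp_all add: inner_commute)
  have orth: "I x \<bullet> K x = 0" "I x \<bullet> L x = 0" "K x \<bullet> L x = 0"
    using so_inner[OF C_so[OF I(1)], of x "K x"] so_inner[OF C_so[OF I(1)], of x "L x"]
      so_inner[OF C_so[OF K(1)], of x "L x"] sx x(1)
    by (simp_all add: Lx[symmetric] IL KL)
  define \<iota> where "\<iota> = (\<lambda>v::real^3. v$1 *\<^sub>R I x + v$2 *\<^sub>R K x + v$3 *\<^sub>R L x)"
  note frame = quaternion_frame_of_orthonormal[OF x(2) norms sx orth \<iota>_def]
  interpret quaternion_frame x \<iota> by (rule frame(1))
  have emb: "emb r v = r *\<^sub>R x + (v$1 *\<^sub>R I x + v$2 *\<^sub>R K x + v$3 *\<^sub>R L x)" for r v
    unfolding emb_def by (simp add: \<iota>_def)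
  have E_quat: "E = quat"
  proof
    show "E \<subseteq> quat"
    proof
      fix y assume "y \<in> E"
      then obtain r N where y: "y = r *\<^sub>R x + blinfun_apply N x" "N \<in> C"
        using E_generated[OF x(1) x0] by blast
      then obtain a b c where "N = a *\<^sub>R I + b *\<^sub>R K + c *\<^sub>R L" using C_span by blast
      then show "y \<in> quat"
        unfolding frame(2) using y by (simp add: blinfun.bilinear_simps span_add span_scale span_base)
    qed
    show "quat \<subseteq> E"
      unfolding frame(2) using x(1) inE subspace_E by (simp add: span_minimal)
  qed
  have "pairwise orthogonal {x, I x, K x, L x}"
    using sx orth by (auto simp: pairwise_insert orthogonal_def inner_commute)
  moreover have nz: "I x \<noteq> 0" "K x \<noteq> 0" "L x \<noteq> 0" using norms by auto
  ultimately have "independent {x, I x, K x, L x}"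
    using x0 by (intro pairwise_orthogonal_independent) auto
  moreover have "x \<noteq> I x" "x \<noteq> K x" "x \<noteq> L x" "I x \<noteq> K x" "I x \<noteq> L x" "K x \<noteq> L x"
    using sx orth norms x(2) by auto
  then have "card {x, I x, K x, L x} = 4" by simp
  ultimately have "dim E = 4"
    using dim_span_eq_card_independent by (metis E_quat frame(2))
  \<comment> \<open>In this frame \<open>I\<close>, \<open>K\<close>, \<open>L\<close> are left
    multiplications by the imaginary units. \<open>J\<close> commutes with them and sends the unit
    \<open>x\<close> to an imaginary element, so it is right multiplication by that element; hence
    the sign -1.\<close>
  moreover have "J o\<^sub>L proj E = qmult (- 1) (im (J x))" if J: "J \<in> V" for J
  proof (rule so_on_eqI[OF subspace_E])
    have Jso: "J \<in> so" using J V_so by blast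
    have "J o\<^sub>L proj E = proj E o\<^sub>L J o\<^sub>L proj E"
      using V_E[OF J] proj_in[OF subspace_E] proj_id[OF subspace_E] by (auto intro!: blinfun_eqI)
    then show "J o\<^sub>L proj E \<in> so_on E"
      using proj_compress_so_on[OF subspace_E Jso] by simp
    show "qmult (- 1) (im (J x)) \<in> so_on E" using qmult_so_on by (simp add: E_quat)
    fix y assume y: "y \<in> E"
    define a where "a = im (J x)"
    define r w where "r = re y" and "w = im y"
    have "re (J x) = 0" using so_inner_self[OF Jso] by (simp add: re_def)
    then have Jx: "J x = a$1 *\<^sub>R I x + a$2 *\<^sub>R K x + a$3 *\<^sub>R L x"
      using quat_emb[of "J x"] V_E[OF J x(1)] by (simp add: E_quat a_def emb)
    have y_eq: "y = r *\<^sub>R x + w$1 *\<^sub>R I x + w$2 *\<^sub>R K x + w$3 *\<^sub>R L x"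
      using quat_emb[of y] y by (simp add: E_quat r_def w_def emb add.assoc)
    have "J y = r *\<^sub>R J x + w$1 *\<^sub>R I (J x) + w$2 *\<^sub>R K (J x) + w$3 *\<^sub>R L (J x)"
      unfolding y_eq
      by (simp add: blinfun.bilinear_simps C_commute[OF I(1) J] C_commute[OF K(1) J] C_commute[OF L J])
    also have "\<dots> = emb (- (a \<bullet> w)) (r *\<^sub>R a - cross3 a w)"
      unfolding Jx emb
      by (simp add: blinfun.bilinear_simps x(1) I(2) K(2) IK Lx[symmetric] LI IL LK KL LL cross_components
        inner_vec_def sum_3 algebra_simps)
    also have "\<dots> = qmult (- 1) a y" by (simp add: qmult_apply r_def w_def)
    finally show "(J o\<^sub>L proj E) y = qmult (- 1) (im (J x)) y"
      using y by (simp add: a_def proj_id[OF subspace_E])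
  qed
  then have "\<forall>J\<in>V. J o\<^sub>L proj E \<in> range (qmult (- 1))" by blast
  moreover have "so4_summand (range (qmult (- 1))) E"
    unfolding E_quat by (rule qmult_so4_summand) simp
  ultimately show ?thesis by blast
qed

text \<open>Split by the size of \<open>C\<close>: zero, a line, or more. The complex case records
  nothing about \<open>V\<close>, because a nice subalgebra contains all of
  \<open>so_on (W j)\<close>.\<close>

lemma irreducible_cases:
  obtains (trivial) "dim E = 1" "\<And>J x. J \<in> V \<Longrightarrow> x \<in> E \<Longrightarrow> J x = 0"
  | (complex) "dim E = 2"
  | (quaternionic) s where "dim E = 4" "so4_summand s E" "\<And>J. J \<in> V \<Longrightarrow> J o\<^sub>L proj E \<in> s"
proof -
  consider "C = {0}" | N where "N \<in> C" "N \<noteq> 0" using subspace_0[OF subspace_C] by blast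
  then show thesis
  proof cases
    case 1
    show thesis by (rule trivial) (use dim_eq_1_if_C_trivial[OF 1] in auto)
  next
    case 2
    from C_normalize[OF this] obtain r where r: "\<And>x. x \<in> E \<Longrightarrow> (r *\<^sub>R N) ((r *\<^sub>R N) x) = - x"
      by blast
    define I where "I = r *\<^sub>R N"
    have I: "I \<in> C" "\<And>x. x \<in> E \<Longrightarrow> I (I x) = - x"
      using r 2(1) subspace_C by (auto simp: I_def subspace_scale)
    show thesis
    proof (cases "C \<subseteq> span {I}")
      case True
      show thesis by (rule complex, rule dim_eq_2_if_C_line[OF I True])
    next
      case False
      from anticommuting_exists[OF I this] obtain K where K: "K \<in> C" "\<And>x. x \<in> E \<Longrightarrow> K (K x) = - x"
        "\<And>x. x \<in> E \<Longrightarrow> I (K x) = - K (I x)"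
        by blast
      then have "K (I x) = - I (K x)" if "x \<in> E" for x using that by simp
      from quaternionic_case[OF I K(1,2) this] obtain s
        where "dim E = 4" "so4_summand s E" "\<forall>J\<in>V. J o\<^sub>L proj E \<in> s" by auto
      then show thesis by (intro quaternionic) auto
    qed
  qed
qed

end

section \<open>Subspaces of centralizer type\<close>

text \<open>The resolution of the identity into projections, composed with \<open>J\<close>; it
  reduces membership in \<open>f\<close> to one block at a time.\<close>

lemma sum_proj_orthogonal_family:
  fixes J :: "'a::euclidean_space \<Rightarrow>\<^sub>L 'a"
  assumes fin: "finite \<E>" and sub: "\<And>E. E \<in> \<E> \<Longrightarrow> subspace E"
    and orth: "pairwise orthogonal_sets \<E>" and span: "span (\<Union>\<E>) = UNIV"
  shows "J = (\<Sum>E\<in>\<E>. J o\<^sub>L proj E)"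
proof (rule blinfun_eqI)
  fix x :: 'a
  have "x \<in> span (\<Union>\<E>)" using span by simp
  then show "J x = (\<Sum>E\<in>\<E>. J o\<^sub>L proj E) x"
  proof (rule linear_eq_on_span[rotated 3])
    fix y assume "y \<in> \<Union>\<E>"
    then obtain F where F: "F \<in> \<E>" "y \<in> F" by blast
    have "(\<Sum>E\<in>\<E>. J o\<^sub>L proj E) y = (\<Sum>E\<in>\<E>. J (proj E y))"
      by (simp add: blinfun.sum_left)
    also have "\<dots> = (\<Sum>E\<in>\<E>. if E = F then J y else 0)"
    proof (rule sum.cong)
      fix E assume E: "E \<in> \<E>"
      show "J (proj E y) = (if E = F then J y else 0)"
      proof (cases "E = F")
        case True
        then show ?thesis using F sub by (simp add: proj_id)
      next
        case False
        then have "orthogonal_sets E F" using orth E F(1) by (simp add: pairwise_def)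
        then have "proj E y = 0"
          using F(2) sub[OF E] by (intro proj_orthogonal) (auto simp: orthogonal_sets_def)
        then show ?thesis using False by simp
      qed
    qed simp
    also have "\<dots> = J y" using fin F(1) by simp
    finally show "J y = (\<Sum>E\<in>\<E>. J o\<^sub>L proj E) y" by simp
  qed (auto intro: bounded_linear.linear blinfun.bounded_linear_right)
qed

lemma orthogonal_sets_span_Union:
  assumes "\<And>F. F \<in> \<F> \<Longrightarrow> orthogonal_sets E F"
  shows "orthogonal_sets E (span (\<Union>\<F>))"
  using assms unfolding orthogonal_sets_def by (auto intro: orthogonal_to_span)

lemma centralizer_type_imp_nice_subalgebra:
  fixes V :: "('a::euclidean_space \<Rightarrow>\<^sub>L 'a) set"
  assumes V: "V \<subseteq> so" and cent: "centralizer_type V"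
  shows "\<exists>f. nice_subalgebra f \<and> V \<subseteq> f"
proof -
  have "invariant_under V UNIV" by (simp add: invariant_under_def)
  from orthogonal_irreducible_decomposition[OF V this] obtain \<E> where \<E>: "finite \<E>" "\<And>E. E \<in> \<E> \<Longrightarrow> irreducible_under V E"
    "pairwise orthogonal_sets \<E>" "span (\<Union>\<E>) = UNIV"
    by blast
  have loc: "centralized_irreducible V E" if "E \<in> \<E>" for E
    using V cent \<E>(2)[OF that] by (rule centralized_irreducible.intro)
  have sub: "subspace E" if "E \<in> \<E>" for E
    using centralized_irreducible.subspace_E[OF loc[OF that]] .
  define D where "D k = {E \<in> \<E>. dim E = k}" for k
  have finD: "finite (D k)" for k using \<E>(1) by (simp add: D_def)
  obtain U where U: "bij_betw U {0..<card (D 4)} (D 4)" using ex_bij_betw_nat_finite[OF finD] by blast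
  obtain W where W: "bij_betw W {0..<card (D 2)} (D 2)" using ex_bij_betw_nat_finite[OF finD] by blast
  define p q where "p = card (D 4)" and "q = card (D 2)"
  have imU: "U ` {..<p} = D 4" and imW: "W ` {..<q} = D 2"
    and injU: "inj_on U {..<p}" and injW: "inj_on W {..<q}"
    using U W by (simp_all add: bij_betw_def p_def q_def lessThan_atLeast0)
  have U_D: "i < p \<Longrightarrow> U i \<in> D 4" and W_D: "j < q \<Longrightarrow> W j \<in> D 2" for i j
    using imU imW by blast+
  have orth: "orthogonal_sets E F" if "E \<in> D k" "F \<in> D l" "E \<noteq> F" for E F k l
    using that \<E>(3) by (auto simp: D_def pairwise_def)
  have orth_neq: "orthogonal_sets E F" if "E \<in> D k" "F \<in> D l" "k \<noteq> l" for E F k l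
    using that orth[OF that(1,2)] by (auto simp: D_def)
  \<comment> \<open>The one-dimensional summands, on which \<open>V\<close> vanishes, make up the
    part of the space without a generator.\<close>
  define Z where "Z = span (\<Union>(D 1))"
  define s where "s i = (SOME s. so4_summand s (U i) \<and> (\<forall>J\<in>V. J o\<^sub>L proj (U i) \<in> s))" for i
  have s: "so4_summand (s i) (U i) \<and> (\<forall>J\<in>V. J o\<^sub>L proj (U i) \<in> s i)" if "i < p" for i
  proof -
    have "U i \<in> \<E>" "dim (U i) = 4" using U_D[OF that] by (auto simp: D_def)
    then have "\<exists>s. so4_summand s (U i) \<and> (\<forall>J\<in>V. J o\<^sub>L proj (U i) \<in> s)"
      by (cases rule: centralized_irreducible.irreducible_cases[OF loc]) auto
    then show ?thesis unfolding s_def by (rule someI_ex)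
  qed
  have cover: "\<E> = D 4 \<union> D 2 \<union> D 1"
  proof -
    have "dim E = 4 \<or> dim E = 2 \<or> dim E = 1" if "E \<in> \<E>" for E
      by (cases rule: centralized_irreducible.irreducible_cases[OF loc[OF that]]) auto
    then show ?thesis by (auto simp: D_def)
  qed
  have dec: "nice_decomposition p q U W Z"
    unfolding nice_decomposition_def
  proof (intro conjI allI impI)
    fix i assume "i < p"
    then show "subspace (U i)" "dim (U i) = 4" using U_D[of i] sub by (auto simp: D_def)
    show "orthogonal_sets (U i) Z"
      unfolding Z_def using U_D[OF \<open>i < p\<close>] by (intro orthogonal_sets_span_Union orth_neq) auto
  next
    fix j assume "j < q"
    then show "subspace (W j)" "dim (W j) = 2" using W_D[of j] sub by (auto simp: D_def)
    show "orthogonal_sets (W j) Z"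
      unfolding Z_def using W_D[OF \<open>j < q\<close>] by (intro orthogonal_sets_span_Union orth_neq) auto
  next
    fix i i' assume *: "i < p" "i' < p" "i \<noteq> i'"
    then have "U i \<noteq> U i'" using injU by (auto simp: inj_on_def)
    then show "orthogonal_sets (U i) (U i')" using * U_D by (intro orth)
  next
    fix j j' assume *: "j < q" "j' < q" "j \<noteq> j'"
    then have "W j \<noteq> W j'" using injW by (auto simp: inj_on_def)
    then show "orthogonal_sets (W j) (W j')" using * W_D by (intro orth)
  next
    fix i j assume "i < p" "j < q"
    then show "orthogonal_sets (U i) (W j)" using U_D W_D by (intro orth_neq) auto
  next
    show "subspace Z" by (simp add: Z_def)
    have "\<Union>\<E> \<subseteq> (\<Union>i<p. U i) \<union> (\<Union>j<q. W j) \<union> Z"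
      unfolding cover imU imW Z_def using span_superset[of "\<Union>(D 1)"] by blast
    then show "span ((\<Union>i<p. U i) \<union> (\<Union>j<q. W j) \<union> Z) = UNIV"
      using span_mono \<E>(4) by (metis top.extremum_uniqueI)
  qed
  define f where "f = span ((\<Union>i<p. s i) \<union> (\<Union>j<q. so_on (W j)))"
  have "nice_subalgebra f"
    unfolding f_def using dec s by (intro nice_subalgebra_span) auto
  moreover have "J \<in> f" if J: "J \<in> V" for J
  proof -
    have "J o\<^sub>L proj E \<in> f" if E: "E \<in> \<E>" for E
    proof -
      consider "E \<in> D 4" | "E \<in> D 2" | "E \<in> D 1" using E cover by blast
      then show ?thesis
      proof cases
        case 1
        then obtain i where "i < p" "E = U i" using imU by blast
        then show ?thesis using s J unfolding f_def by (intro span_base) blast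
      next
        case 2
        then obtain j where j: "j < q" "E = W j" using imW by blast
        have "J o\<^sub>L proj E = proj E o\<^sub>L J o\<^sub>L proj E"
          using centralized_irreducible.V_E[OF loc[OF E] J] sub[OF E]
          by (auto intro!: blinfun_eqI simp: proj_in proj_id)
        then have "J o\<^sub>L proj E \<in> so_on E"
          using proj_compress_so_on[OF sub[OF E]] V J by auto
        then show ?thesis using j unfolding f_def by (intro span_base) blast
      next
        case 3
        then have "dim E = 1" by (simp add: D_def)
        \<comment> \<open>Dimension 1 excludes the complex and quaternionic cases, leaving the
          trivial action.\<close>
        then have "J x = 0" if "x \<in> E" for x
          using J that by (cases rule: centralized_irreducible.irreducible_cases[OF loc[OF E]]) auto
        then have "J o\<^sub>L proj E = 0"
          using proj_in[OF sub[OF E]] by (auto intro!: blinfun_eqI)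
        then show ?thesis by (simp add: f_def span_zero)
      qed
    qed
    then have "(\<Sum>E\<in>\<E>. J o\<^sub>L proj E) \<in> f" unfolding f_def by (rule span_sum)
    then show ?thesis using sum_proj_orthogonal_family[OF \<E>(1) sub \<E>(3,4), of J] by simp
  qed
  ultimately show ?thesis by blast
qed

theorem proposition1:
  fixes V :: "('a::euclidean_space \<Rightarrow>\<^sub>L 'a) set"
  assumes "subspace V" and "V \<subseteq> so" and "GO_subspace V"
  shows "centralizer_type V \<longleftrightarrow> (\<exists>f. nice_subalgebra f \<and> V \<subseteq> f)"
  using centralizer_type_imp_nice_subalgebra[OF assms(2)] nice_subalgebra_imp_centralizer_type by blast

end
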